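(* For $X>0$ let $I(X)$ be the number of imaginary quadratic fields $K$ with $|\Delta_K| < X$ such that there exists an elliptic curve $E/K$ with everywhere good reduction over $K$ and rational $j$-invariant $j(E)\in\mathbb{Q}$. Then $$I(X) \gg \frac{X}{\sqrt{\log X}}.$$
   Context: $\Delta_K$ denotes the discriminant of $K$. An elliptic curve $E/K$ has everywhere good reduction if it has good reduction at every prime of $\mathcal{O}_K$. *)

theory Defs
  imports "HOL-Analysis.Analysis" "HOL-Computational_Algebra.Computational_Algebra"
begin

definition qfield :: "int \<Rightarrow> complex set" where
  "qfield d = {of_rat a + of_rat b * csqrt (of_int d) | a b. True}"

text \<open>Discriminant of Q(sqrt d) for squarefree d.\<close>
definition qdisc :: "int \<Rightarrow> int" where
  "qdisc d = (if d mod 4 = 1 then d else 4 * d)"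

definition ring_of_integers :: "complex set \<Rightarrow> complex set" where
  "ring_of_integers K = {x \<in> K. algebraic_int x}"

definition nonzero_prime_ideal :: "complex set \<Rightarrow> complex set \<Rightarrow> bool" where
  "nonzero_prime_ideal OK P \<longleftrightarrow>
     P \<subseteq> OK \<and> 0 \<in> P \<and> (\<forall>x\<in>P. \<forall>y\<in>P. x + y \<in> P) \<and>
     (\<forall>r\<in>OK. \<forall>x\<in>P. r * x \<in> P) \<and> P \<noteq> {0} \<and> P \<noteq> OK \<and>
     (\<forall>a\<in>OK. \<forall>b\<in>OK. a * b \<in> P \<longrightarrow> a \<in> P \<or> b \<in> P)"

definition localization :: "complex set \<Rightarrow> complex set \<Rightarrow> complex set" where
  "localization OK P = {a / b | a b. a \<in> OK \<and> b \<in> OK \<and> b \<notin> P}"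

text \<open>Standard quantities attached to a Weierstrass equation
  y^2 + a1 x y + a3 y = x^3 + a2 x^2 + a4 x + a6.\<close>
definition wdisc :: "complex \<Rightarrow> complex \<Rightarrow> complex \<Rightarrow> complex \<Rightarrow> complex \<Rightarrow> complex" where
  "wdisc a1 a2 a3 a4 a6 =
    (let b2 = a1^2 + 4*a2; b4 = 2*a4 + a1*a3; b6 = a3^2 + 4*a6;
         b8 = a1^2*a6 + 4*a2*a6 - a1*a3*a4 + a2*a3^2 - a4^2
     in - (b2^2*b8) - 8*b4^3 - 27*b6^2 + 9*b2*b4*b6)"

definition wj :: "complex \<Rightarrow> complex \<Rightarrow> complex \<Rightarrow> complex \<Rightarrow> complex \<Rightarrow> complex" where
  "wj a1 a2 a3 a4 a6 =
    (let b2 = a1^2 + 4*a2; b4 = 2*a4 + a1*a3; c4 = b2^2 - 24*b4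
     in c4^3 / wdisc a1 a2 a3 a4 a6)"

definition elliptic_over :: "complex set \<Rightarrow> complex \<Rightarrow> complex \<Rightarrow> complex \<Rightarrow> complex \<Rightarrow> complex \<Rightarrow> bool" where
  "elliptic_over K a1 a2 a3 a4 a6 \<longleftrightarrow>
     a1 \<in> K \<and> a2 \<in> K \<and> a3 \<in> K \<and> a4 \<in> K \<and> a6 \<in> K \<and> wdisc a1 a2 a3 a4 a6 \<noteq> 0"

text \<open>Good reduction at P: some K-isomorphic Weierstrass model (change of variables
  x = u^2 x' + r, y = u^3 y' + s u^2 x' + t) is P-integral with P-unit discriminant.\<close>
definition good_reduction_at ::
  "complex set \<Rightarrow> complex set \<Rightarrow> complex \<Rightarrow> complex \<Rightarrow> complex \<Rightarrow> complex \<Rightarrow> complex \<Rightarrow> bool" where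
  "good_reduction_at K P a1 a2 a3 a4 a6 \<longleftrightarrow>
     (\<exists>uu\<in>K. \<exists>rr\<in>K. \<exists>ss\<in>K. \<exists>tt\<in>K. uu \<noteq> 0 \<and>
       (let R = localization (ring_of_integers K) P;
            a1' = (a1 + 2* ss) / uu;
            a2' = (a2 - ss*a1 + 3*rr - ss^2) / uu^2;
            a3' = (a3 + rr*a1 + 2*tt) / uu^3;
            a4' = (a4 - ss*a3 + 2*rr*a2 - (tt + rr* ss)*a1 + 3*rr^2 - 2* ss*tt) / uu^4;
            a6' = (a6 + rr*a4 + rr^2*a2 + rr^3 - tt*a3 - tt^2 - rr*tt*a1) / uu^6;
            D' = wdisc a1' a2' a3' a4' a6'
        in a1' \<in> R \<and> a2' \<in> R \<and> a3' \<in> R \<and> a4' \<in> R \<and> a6' \<in> R \<and>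
           D' \<in> R \<and> inverse D' \<in> R))"

definition everywhere_good_reduction ::
  "complex set \<Rightarrow> complex \<Rightarrow> complex \<Rightarrow> complex \<Rightarrow> complex \<Rightarrow> complex \<Rightarrow> bool" where
  "everywhere_good_reduction K a1 a2 a3 a4 a6 \<longleftrightarrow>
     (\<forall>P. nonzero_prime_ideal (ring_of_integers K) P \<longrightarrow> good_reduction_at K P a1 a2 a3 a4 a6)"

text \<open>I(X): imaginary quadratic fields Q(sqrt d) (d < 0 squarefree, in bijection with the
  fields) with |disc| < X admitting an elliptic curve with everywhere good reduction and
  rational j-invariant.\<close>
definition I_count :: "real \<Rightarrow> nat" where
  "I_count X = card {d :: int. d < 0 \<and> squarefree d \<and> real_of_int \<bar>qdisc d\<bar> < X \<and>
     (\<exists>a1 a2 a3 a4 a6. elliptic_over (qfield d) a1 a2 a3 a4 a6 \<and>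
        everywhere_good_reduction (qfield d) a1 a2 a3 a4 a6 \<and>
        wj a1 a2 a3 a4 a6 \<in> \<rat>)}"

end

theory Submission
  imports Defs "HOL-Number_Theory.Number_Theory" "HOL-Library.Discrete_Functions"
    "HOL-Real_Asymp.Real_Asymp"
begin

text \<open>
  The curve \<open>y\<^sup>2 + y = x\<^sup>3 + x\<^sup>2 - 12 x - 17\<close> has discriminant \<open>37\<^sup>3\<close> and \<open>j = 4096 = 16\<^sup>3\<close>;
  its twist by \<open>\<mu>\<close> is \<open>y\<^sup>2 = x\<^sup>3 + \<mu> x\<^sup>2 - 12 \<mu>\<^sup>2 x - 67 \<mu>\<^sup>3 / 4\<close>. Let \<open>K = Q(w)\<close> with
  \<open>w\<^sup>2 = - 37 m\<close>. A solution of \<open>z\<^sup>2 = 37 x\<^sup>2 + 4 m y\<^sup>2\<close> yields \<open>\<mu> = 37 x + 2 y w\<close> of norm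
  \<open>37 z\<^sup>2\<close>, and if \<open>m mod 4 = 3\<close> its sign can be chosen so that \<open>\<mu>\<close> is 1 modulo 4, which gives
  an integral model with discriminant \<open>37\<^sup>3 \<mu>\<^sup>6\<close>. At a prime above 37 rescaling by \<open>u = w\<close> makes the
  discriminant a unit, at any other prime dividing \<open>\<mu>\<close> rescaling by \<open>u = z\<close> does.

  The conic is solvable when all prime factors of \<open>m\<close> split in \<open>Q(\<surd>37)\<close>: a Thue argument makes a
  multiple \<open>k p\<close> with \<open>\<bar>k\<bar> \<le> 6\<close> of such a prime \<open>p\<close> a norm, and every \<open>k\<close> that can occur is a norm
  up to squares. Since 3 is a norm up to squares as well, either \<open>n\<close> or \<open>3 n\<close> is an admissible \<open>m\<close>
  whenever \<open>n\<close> is a squarefree product of split primes other than 3.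

  By Mertens' estimates, twisted by the Legendre symbol modulo 37, the split primes carry half of
  \<open>\<Sum> ln p / p\<close>. Hence the sum of \<open>1 / a\<close> over squarefree products \<open>a \<le> N\<close> of split primes is at least
  of order \<open>\<surd>(ln N)\<close>. Multiplying each such \<open>a\<close> up to about \<open>\<surd>N\<close> by a split prime slightly below
  \<open>N / a\<close> gives distinct integers, of order \<open>N / \<surd>(ln N)\<close> many.
\<close>

section \<open>Integral models over a quadratic field\<close>

text \<open>For d = 1 modulo 4 these are the coordinates of the ring of integers of Q(sqrt d).
  Integrality of coefficients is checked on such coordinates and carried over by
  \<open>half_int_order_subset\<close>.\<close>

definition half_int_order :: "int \<Rightarrow> complex set" where
  "half_int_order d = {(of_int a + of_int b * csqrt (of_int d)) / 2 | a b. even (a - b)}"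

lemma half_int_orderI:
  "even (a - b) \<Longrightarrow> x = (of_int a + of_int b * csqrt (of_int d)) / 2 \<Longrightarrow> x \<in> half_int_order d"
  unfolding half_int_order_def by blast

lemma of_int_half_int_order [simp, intro]: "of_int a \<in> half_int_order d"
  by (rule half_int_orderI[of "2 * a" 0]) auto

lemma numeral_half_int_order [simp, intro]: "numeral a \<in> half_int_order d"
  using of_int_half_int_order[of "numeral a" d] by (simp del: of_int_half_int_order)

lemma one_half_int_order [simp, intro]: "1 \<in> half_int_order d"
  using of_int_half_int_order[of 1 d] by (simp del: of_int_half_int_order)

lemma zero_half_int_order [simp, intro]: "0 \<in> half_int_order d"
  using of_int_half_int_order[of 0 d] by (simp del: of_int_half_int_order)

lemma half_int_order_add [intro]:
  assumes "x \<in> half_int_order d" "y \<in> half_int_order d"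
  shows "x + y \<in> half_int_order d"
proof -
  obtain a b a' b' where ab: "even (a - b)" "even (a' - b')"
    "x = (of_int a + of_int b * csqrt (of_int d)) / 2" "y = (of_int a' + of_int b' * csqrt (of_int d)) / 2"
    using assms unfolding half_int_order_def by blast
  show ?thesis
    by (rule half_int_orderI[of "a + a'" "b + b'"]) (use ab in \<open>auto simp: field_simps\<close>)
qed

lemma half_int_order_mult [intro]:
  assumes d: "d mod 4 = 1" and "x \<in> half_int_order d" "y \<in> half_int_order d"
  shows "x * y \<in> half_int_order d"
proof -
  obtain a b a' b' where ab: "even (a - b)" "even (a' - b')"
    "x = (of_int a + of_int b * csqrt (of_int d)) / 2" "y = (of_int a' + of_int b' * csqrt (of_int d)) / 2"
    using assms unfolding half_int_order_def by blast
  obtain k where k: "d = 1 + 4 * k"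
    using d by (metis mod_mult_div_eq mult.commute)
  obtain e where e: "b = a + 2 * e"
    using ab(1) by (metis add.commute diff_add_cancel dvdE even_diff minus_diff_eq)
  obtain f where f: "b' = a' + 2 * f"
    using ab(2) by (metis add.commute diff_add_cancel dvdE even_diff minus_diff_eq)
  have w: "csqrt (of_int d) * csqrt (of_int d) = 1 + 4 * of_int k"
    using power2_csqrt[of "of_int d"] by (simp add: k power2_eq_square)
  \<comment> \<open>\<open>A\<close> and \<open>B\<close> are (a a' + d b b') / 2 and (a b' + a' b)
    / 2, the coordinates of the product; the substitutions for d, b and b' make them visibly
    integers.\<close>
  define A where "A = a*a' + a*f + a'*e + 2*e*f + 2*k*(a+2*e)*(a'+2*f)"
  define B where "B = a*a' + a*f + e*a'"
  have AB: "A - B = 2 * (e*f + k*(a+2*e)*(a'+2*f))"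
    by (simp add: A_def B_def algebra_simps)
  show ?thesis
  proof (rule half_int_orderI[of A B])
    show "even (A - B)" unfolding AB by simp
    have "4 * (x * y) = (of_int a + of_int b * csqrt (of_int d)) * (of_int a' + of_int b' * csqrt (of_int d))"
      by (simp add: ab)
    also have "\<dots> = of_int (a*a') + of_int (b*b') * (csqrt (of_int d) * csqrt (of_int d))
        + of_int (a*b' + a'*b) * csqrt (of_int d)"
      by (simp add: algebra_simps)
    also have "\<dots> = 2 * (of_int A + of_int B * csqrt (of_int d))"
      unfolding w e f A_def B_def by (simp add: algebra_simps)
    finally have "2 * (x * y * 2) = 2 * (of_int A + of_int B * csqrt (of_int d))" by simp
    then show "x * y = (of_int A + of_int B * csqrt (of_int d)) / 2"
      unfolding mult_cancel_left by simp
  qed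
qed

lemma half_int_order_uminus [intro]:
  assumes "d mod 4 = 1" "x \<in> half_int_order d"
  shows "- x \<in> half_int_order d"
  using half_int_order_mult[OF assms(1) of_int_half_int_order[of "-1" d] assms(2)]
  by simp

lemma half_int_order_power [intro]:
  assumes "d mod 4 = 1" "x \<in> half_int_order d"
  shows "x ^ n \<in> half_int_order d"
  by (induction n) (use assms half_int_order_mult in auto)

lemma half_int_order_subset:
  assumes d: "d mod 4 = 1"
  shows "half_int_order d \<subseteq> ring_of_integers (qfield d)"
proof
  fix x assume "x \<in> half_int_order d"
  then obtain a b where ab: "even (a - b)" "x = (of_int a + of_int b * csqrt (of_int d)) / 2"
    unfolding half_int_order_def by blast
  obtain k where k: "d = 1 + 4 * k"
    using d by (metis mod_mult_div_eq mult.commute)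
  obtain e where e: "b = a + 2 * e"
    using ab(1) by (metis add.commute diff_add_cancel dvdE even_diff minus_diff_eq)
  have w: "csqrt (of_int d) * csqrt (of_int d) = 1 + 4 * of_int k"
    using power2_csqrt[of "of_int d"] by (simp add: k power2_eq_square)
  \<comment> \<open>\<open>c\<close> is the norm (a^2 - d b^2) / 4 and a is the trace, so
    \<open>p\<close> is the characteristic polynomial of x.\<close>
  define c where "c = - (a * e + e * e + k * b * b)"
  define p where "p = [:of_int c, of_int (- a), 1 :: complex:]"
  have "poly p x = of_int c - of_int a * x + x * x"
    by (simp add: p_def algebra_simps)
  also have "4 * \<dots> = 4 * of_int c - of_int (a * a) + of_int (b * b) * (csqrt (of_int d) * csqrt (of_int d))"
    by (simp add: ab field_simps)
  also have "\<dots> = 0"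
    unfolding w by (simp add: c_def e algebra_simps)
  finally have root: "poly p x = 0" by simp
  have "algebraic_int x"
  proof (rule algebraic_int.intros)
    show "lead_coeff p = 1" by (simp add: p_def)
    show "\<forall>i. Polynomial.coeff p i \<in> \<int>" by (auto simp: p_def coeff_pCons split: nat.splits)
  qed (rule root)
  moreover have "x \<in> qfield d"
    unfolding qfield_def
    by (rule CollectI, rule exI[of _ "of_int a / 2"], rule exI[of _ "of_int b / 2"])
       (simp add: ab of_rat_divide field_simps)
  ultimately show "x \<in> ring_of_integers (qfield d)"
    by (simp add: ring_of_integers_def)
qed

lemma ring_of_integers_subset: "ring_of_integers K \<subseteq> K"
  by (auto simp: ring_of_integers_def)

section \<open>Localization of the order at a prime ideal\<close>

locale prime_of_order =
  fixes d :: int and P :: "complex set"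
  assumes d: "d mod 4 = 1"
  assumes P: "nonzero_prime_ideal (ring_of_integers (qfield d)) P"
begin

abbreviation "Ord \<equiv> half_int_order d"

lemma ord_ring: "x \<in> Ord \<Longrightarrow> x \<in> ring_of_integers (qfield d)"
  using half_int_order_subset[OF d] by blast

lemma P_add: "x \<in> P \<Longrightarrow> y \<in> P \<Longrightarrow> x + y \<in> P"
  and P_mult: "r \<in> Ord \<Longrightarrow> x \<in> P \<Longrightarrow> r * x \<in> P"
  and P_prime: "a \<in> Ord \<Longrightarrow> b \<in> Ord \<Longrightarrow> a * b \<in> P \<Longrightarrow> a \<in> P \<or> b \<in> P"
  using P ord_ring unfolding nonzero_prime_ideal_def by blast+

lemma P_one: "1 \<notin> P"
proof
  assume "1 \<in> P"
  then have "\<forall>r\<in>ring_of_integers (qfield d). r * 1 \<in> P"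
    using P unfolding nonzero_prime_ideal_def by blast
  then have "ring_of_integers (qfield d) \<subseteq> P" by auto
  with P show False unfolding nonzero_prime_ideal_def by blast
qed

lemma P_zero: "0 \<in> P"
  using P unfolding nonzero_prime_ideal_def by blast

lemma P_power: "a \<in> Ord \<Longrightarrow> a ^ n \<in> P \<Longrightarrow> a \<in> P"
proof (induction n)
  case (Suc n)
  then show ?case
    using P_prime[of a "a ^ n"] half_int_order_power[OF d, of a n] by auto
qed (use P_one in auto)

lemma P_coprime_int:
  assumes "of_int a \<in> P" "of_int b \<in> P" "coprime a b"
  shows False
proof -
  obtain u v where "u * a + v * b = 1"
    using assms(3) bezout_int[of a b] coprime_iff_gcd_eq_1 by metis
  moreover have "of_int u * of_int a + of_int v * of_int b \<in> P"
    by (intro P_add P_mult assms(1,2)) auto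
  ultimately have "1 \<in> P"
    by (metis of_int_1 of_int_add of_int_mult)
  with P_one show False by simp
qed

text \<open>Fractions with numerator and denominator in the explicit order: units and integral
  elements at P are found here, and \<open>local_ring_subset\<close> places them in
  \<open>localization\<close>.\<close>

definition local_ring :: "complex set" where
  "local_ring = {a / b | a b. a \<in> Ord \<and> b \<in> Ord \<and> b \<notin> P}"

lemma local_ring_subset: "local_ring \<subseteq> localization (ring_of_integers (qfield d)) P"
  unfolding local_ring_def localization_def using ord_ring by blast

lemma local_ringI: "a \<in> Ord \<Longrightarrow> b \<in> Ord \<Longrightarrow> b \<notin> P \<Longrightarrow> a / b \<in> local_ring"
  unfolding local_ring_def by blast

lemma ord_local_ring: "a \<in> Ord \<Longrightarrow> a \<in> local_ring"
  using local_ringI[of a 1] P_one by simp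

lemma inverse_local_ring: "a \<in> Ord \<Longrightarrow> a \<notin> P \<Longrightarrow> inverse a \<in> local_ring"
  using local_ringI[of 1 a] by (simp add: inverse_eq_divide)

lemma local_ring_mult: "x \<in> local_ring \<Longrightarrow> y \<in> local_ring \<Longrightarrow> x * y \<in> local_ring"
proof -
  assume "x \<in> local_ring" "y \<in> local_ring"
  then obtain a b a' b' where *: "x = a / b" "y = a' / b'" "a \<in> Ord" "b \<in> Ord" "b \<notin> P"
    "a' \<in> Ord" "b' \<in> Ord" "b' \<notin> P"
    unfolding local_ring_def by blast
  then have "(a * a') / (b * b') \<in> local_ring"
    using P_prime d by (intro local_ringI half_int_order_mult) auto
  then show ?thesis using * by simp
qed

lemma local_ring_power: "x \<in> local_ring \<Longrightarrow> x ^ n \<in> local_ring"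
  by (induction n) (auto intro: local_ring_mult ord_local_ring)

lemma local_ring_uminus: "x \<in> local_ring \<Longrightarrow> - x \<in> local_ring"
  using local_ring_mult[of "-1" x] ord_local_ring[of "-1"] half_int_order_uminus[OF d, of 1] by simp

end

section \<open>Twists of the curve and their reduction at every prime\<close>

lemma wdisc_twist:
  "wdisc 0 u 1 (- 12 * u^2) ((- 67 * u^3 - 1) / 4) = 37 ^ 3 * u ^ 6"
  unfolding wdisc_def Let_def by (simp add: field_simps) Groebner_Basis.algebra

text \<open>This model arises from that of \<open>wdisc_twist\<close> by shifting y by 1/2, which
  completes the square. The former is integral at 2 when the parameter is 1 modulo 4; the present
  one serves where 2 is invertible.\<close>

lemma wdisc_short1: "wdisc 0 a 0 (- 12 * a ^ 2) (- 67 / 4 * a ^ 3) = 37 ^ 3 * a ^ 6"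
  unfolding wdisc_def Let_def by (simp add: field_simps) Groebner_Basis.algebra

lemma wdisc_short: "wdisc 0 0 0 a b = - 64 * a ^ 3 - 432 * b ^ 2"
  unfolding wdisc_def Let_def by (simp add: field_simps)

text \<open>The new coefficients get names of their own, so that each application can supply closed
  forms whose integrality is evident.\<close>

lemma good_reduction_atI:
  fixes a1 a2 a3 a4 a6 b1 b2 b3 b4 b6 u r s t :: complex
  assumes "u \<in> K" "r \<in> K" "s \<in> K" "t \<in> K" "u \<noteq> 0"
    and "b1 = (a1 + 2 * s) / u"
    and "b2 = (a2 - s * a1 + 3 * r - s ^ 2) / u ^ 2"
    and "b3 = (a3 + r * a1 + 2 * t) / u ^ 3"
    and "b4 = (a4 - s * a3 + 2 * r * a2 - (t + r * s) * a1 + 3 * r ^ 2 - 2 * s * t) / u ^ 4"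
    and "b6 = (a6 + r * a4 + r ^ 2 * a2 + r ^ 3 - t * a3 - t ^ 2 - r * t * a1) / u ^ 6"
    and "{b1, b2, b3, b4, b6, wdisc b1 b2 b3 b4 b6, inverse (wdisc b1 b2 b3 b4 b6)}
           \<subseteq> localization (ring_of_integers K) P"
  shows "good_reduction_at K P a1 a2 a3 a4 a6"
  using assms unfolding good_reduction_at_def Let_def by blast

text \<open>The congruences on x and y make \<open>\<mu>\<close> congruent to 1 modulo 4 in the
  order: (37 x - 1) / 2 and y are both odd, so ((37 x - 1) / 2 + y w) / 2 is integral. Coprimality
  of x and z separates \<open>\<mu>\<close> from its conjugate at primes not above 2 or 37.\<close>

locale conic_point =
  fixes n x y z :: int
  assumes n_pos: "n > 0" and n_mod_4: "n mod 4 = 3" and n_37: "\<not> 37 dvd n"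
    and coprime_xz: "coprime x z" and x_mod_4: "x mod 4 = 3" and odd_y: "odd y"
    and conic: "z ^ 2 = 37 * x ^ 2 + 4 * n * y ^ 2"
begin

definition "d = - 37 * n"
definition "w = csqrt (of_int d)"
definition "\<mu> = 37 * of_int x + 2 * of_int y * w"
definition "\<mu>' = 37 * of_int x - 2 * of_int y * w"

lemma d_mod_4: "d mod 4 = 1"
  using n_mod_4 unfolding d_def by presburger

lemma w_square: "w ^ 2 = - 37 * of_int n"
  unfolding w_def power2_csqrt by (simp add: d_def)

lemma z_nonzero: "z \<noteq> 0"
proof
  assume "z = 0"
  with conic have "37 * x ^ 2 + 4 * n * y ^ 2 = 0" by simp
  moreover have "4 * n * y ^ 2 \<ge> 0" using n_pos by simp
  ultimately have "x = 0" by (smt (verit) zero_less_power2)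
  with x_mod_4 show False by simp
qed

text \<open>If 37 divided z, it would divide 4 n y^2 and hence y; then 37^2 would divide 37 x^2, so
  37 would divide x as well, against coprimality.\<close>

lemma z_37: "\<not> 37 dvd z"
proof
  have p: "prime (37::int)" by simp
  assume z: "37 dvd z"
  then obtain z' where z': "z = 37 * z'" by blast
  from conic have "4 * n * y ^ 2 = 37 * (37 * z' ^ 2 - x ^ 2)"
    unfolding z' by (simp add: power2_eq_square)
  then have "37 dvd 4 * n * y ^ 2" by simp
  then have "37 dvd (4::int) \<or> 37 dvd y"
    using n_37 p by (simp add: prime_dvd_mult_iff prime_dvd_power_iff)
  then have "37 dvd y" by auto
  then obtain y' where y': "y = 37 * y'" by blast
  from conic have "x ^ 2 = 37 * (z' ^ 2 - 4 * n * y' ^ 2)"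
    unfolding z' y' by (simp add: power2_eq_square algebra_simps)
  then have "37 dvd x ^ 2" by simp
  then have "37 dvd x" using p by (simp add: prime_dvd_power_iff)
  with z coprime_xz show False
    using not_coprimeI[of 37 x z] by auto
qed

lemma w_ord: "w \<in> half_int_order d"
  by (rule half_int_orderI[of 0 2]) (auto simp: w_def)

lemma \<mu>_ord: "\<mu> \<in> half_int_order d"
  by (rule half_int_orderI[of "74 * x" "4 * y"]) (auto simp: w_def \<mu>_def field_simps)

lemma \<mu>'_ord: "\<mu>' \<in> half_int_order d"
  by (rule half_int_orderI[of "74 * x" "- (4 * y)"]) (auto simp: w_def \<mu>'_def field_simps)

lemma \<mu>_sub_1_ord: "(\<mu> - 1) / 4 \<in> half_int_order d"
proof -
  obtain k where k: "x = 3 + 4 * k" using x_mod_4 by (metis add.commute mult.commute mod_div_mult_eq)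
  have "(\<mu> - 1) / 4 = (of_int (55 + 74 * k) + of_int y * csqrt (of_int d)) / 2"
    unfolding \<mu>_def w_def by (simp add: k field_simps)
  with odd_y show ?thesis
    by (intro half_int_orderI[of "55 + 74 * k" y]) auto
qed

lemma norm_\<mu>: "\<mu> * \<mu>' = 37 * of_int z ^ 2"
proof -
  have "(of_int z :: complex) ^ 2 = 37 * of_int x ^ 2 + 4 * of_int n * of_int y ^ 2"
    using arg_cong[OF conic, of "of_int :: int \<Rightarrow> complex"] by simp
  then show ?thesis using w_square unfolding \<mu>_def \<mu>'_def by Groebner_Basis.algebra
qed

lemma \<mu>_nonzero: "\<mu> \<noteq> 0" and \<mu>'_nonzero: "\<mu>' \<noteq> 0"
  using norm_\<mu> z_nonzero by auto

text \<open>\<open>v\<close> is \<open>\<mu>\<close>^2 / 37. Its norm z^4 is prime to 37, so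
  \<open>v\<close> is a unit at the primes above 37.\<close>

definition "v = 37 * of_int x ^ 2 - 4 * of_int n * of_int y ^ 2 + 4 * of_int x * of_int y * w"
definition "v' = 37 * of_int x ^ 2 - 4 * of_int n * of_int y ^ 2 - 4 * of_int x * of_int y * w"

lemma \<mu>_square: "\<mu> ^ 2 = 37 * v"
  using w_square unfolding \<mu>_def v_def by Groebner_Basis.algebra

lemma norm_v: "v * v' = of_int z ^ 4"
proof -
  have "(of_int z :: complex) ^ 2 = 37 * of_int x ^ 2 + 4 * of_int n * of_int y ^ 2"
    using arg_cong[OF conic, of "of_int :: int \<Rightarrow> complex"] by simp
  then show ?thesis using w_square unfolding v_def v'_def by Groebner_Basis.algebra
qed

lemma v_ord: "v \<in> half_int_order d" and v'_ord: "v' \<in> half_int_order d"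
  by (rule half_int_orderI[of "2 * (37 * x^2 - 4 * n * y^2)" "8 * x * y"]; auto simp: w_def v_def field_simps)
     (rule half_int_orderI[of "2 * (37 * x^2 - 4 * n * y^2)" "- (8 * x * y)"]; auto simp: w_def v'_def field_simps)

lemma qfield_d: "half_int_order d \<subseteq> qfield d"
  using half_int_order_subset[OF d_mod_4] ring_of_integers_subset by blast

lemma a6_ord: "(- 67 * \<mu> ^ 3 - 1) / 4 \<in> half_int_order d"
proof -
  \<comment> \<open>Split -67 \<open>\<mu>\<close>^3 - 1 as -68 \<open>\<mu>\<close>^3 plus
    \<open>\<mu>\<close>^3 - 1; the second summand is divisible by \<open>\<mu>\<close> - 1, hence
    by 4.\<close>
  have "(- 67 * \<mu> ^ 3 - 1) / 4 = of_int (-17) * \<mu> ^ 3 + (\<mu> - 1) / 4 * (\<mu> ^ 2 + \<mu> + 1)"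
    by (simp add: field_simps power2_eq_square power3_eq_cube)
  also have "\<dots> \<in> half_int_order d"
    using d_mod_4 \<mu>_ord \<mu>_sub_1_ord
    by (intro half_int_order_add half_int_order_mult half_int_order_power) auto
  finally show ?thesis .
qed

lemma a4_ord: "- 12 * \<mu> ^ 2 \<in> half_int_order d"
  using half_int_order_mult[OF d_mod_4 of_int_half_int_order[of "-12"] half_int_order_power[OF d_mod_4 \<mu>_ord, of 2]]
  by simp

lemma elliptic_over_qfield:
  "elliptic_over (qfield d) 0 \<mu> 1 (- 12 * \<mu> ^ 2) ((- 67 * \<mu> ^ 3 - 1) / 4)"
  unfolding elliptic_over_def wdisc_twist
  using qfield_d \<mu>_ord a4_ord a6_ord \<mu>_nonzero zero_half_int_order one_half_int_order by auto

lemma wj_rational: "wj 0 \<mu> 1 (- 12 * \<mu> ^ 2) ((- 67 * \<mu> ^ 3 - 1) / 4) \<in> \<rat>"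
proof -
  have "wj 0 \<mu> 1 (- 12 * \<mu> ^ 2) ((- 67 * \<mu> ^ 3 - 1) / 4) = 4096"
    unfolding wj_def wdisc_twist Let_def using \<mu>_nonzero
    by (simp add: field_simps)
  then show ?thesis by simp
qed

lemma good_reduction:
  assumes P: "nonzero_prime_ideal (ring_of_integers (qfield d)) P"
  shows "good_reduction_at (qfield d) P 0 \<mu> 1 (- 12 * \<mu> ^ 2) ((- 67 * \<mu> ^ 3 - 1) / 4)"
proof -
  interpret prime_of_order d P
    by unfold_locales (use d_mod_4 P in auto)
  let ?R = "localization (ring_of_integers (qfield d)) P"
  note R = subsetD[OF local_ring_subset]
  have K: "r * a \<in> qfield d" if "a \<in> half_int_order d" "r \<in> \<rat>" for a r
  proof -
    from that obtain b c where a: "a = (of_int b + of_int c * csqrt (of_int d)) / 2"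
      unfolding half_int_order_def by blast
    from that obtain q where "r = of_rat q" by (auto elim: Rats_cases)
    then show ?thesis
      unfolding qfield_def
      by (intro CollectI exI[of _ "q * (of_int b / 2)"] exI[of _ "q * (of_int c / 2)"])
         (simp add: a of_rat_mult of_rat_divide field_simps)
  qed
  \<comment> \<open>Where the model has to be changed, 2 is invertible, so the square can be
    completed. If \<open>\<mu>\<close> and 2 were in P, then \<open>\<mu>\<close> - 1, a multiple of
    4, would be in P too, and so would 1.\<close>
  have two: "2 \<notin> P" if "\<mu> \<in> P \<or> 37 \<in> P"
  proof
    assume two: "2 \<in> P"
    show False
    proof (cases "37 \<in> P")
      case True
      then show False using P_coprime_int[of 2 37] two by auto
    next
      case False
      with that have "\<mu> \<in> P" by auto
      have "2 * ((\<mu> - 1) / 4) * 2 \<in> P"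
        by (intro P_mult two half_int_order_mult d_mod_4 \<mu>_sub_1_ord) auto
      moreover have "2 * ((\<mu> - 1) / 4) * 2 = \<mu> - 1" by (simp add: field_simps)
      ultimately have "\<mu> - 1 \<in> P" by (simp only:)
      then have "(-1) * (\<mu> - 1) \<in> P"
        using P_mult half_int_order_uminus[OF d_mod_4 one_half_int_order] by blast
      from P_add[OF this \<open>\<mu> \<in> P\<close>] have "1 \<in> P" by simp
      with P_one show False by simp
    qed
  qed
  have zK: "0 \<in> qfield d" "1 \<in> qfield d" "- 1 / 2 \<in> qfield d"
    using K[of 1 0] K[of 1 1] K[of 1 "-1/2"] by auto
  consider (B) "37 \<in> P" | (C) "\<mu> \<in> P" "37 \<notin> P" | (A) "\<mu> \<notin> P" "37 \<notin> P" by blast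
  then show ?thesis
  proof cases
    \<comment> \<open>The given model already works: it is integral and its discriminant 37^3
      \<open>\<mu>\<close>^6 is a unit at P.\<close>
    case A
    have "37 ^ 3 * \<mu> ^ 6 \<notin> P"
      using A P_prime[of "37 ^ 3" "\<mu> ^ 6"] P_power[of 37 3] P_power[OF \<mu>_ord, of 6]
        half_int_order_power[OF d_mod_4] \<mu>_ord by auto
    moreover have "37 ^ 3 * \<mu> ^ 6 \<in> half_int_order d"
      by (intro half_int_order_mult half_int_order_power d_mod_4 \<mu>_ord) auto
    ultimately have "inverse (37 ^ 3 * \<mu> ^ 6) \<in> ?R" "37 ^ 3 * \<mu> ^ 6 \<in> ?R"
      by (blast intro: R inverse_local_ring ord_local_ring)+
    moreover have "{0, \<mu>, 1, - 12 * \<mu> ^ 2, (- 67 * \<mu> ^ 3 - 1) / 4} \<subseteq> ?R"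
      using \<mu>_ord a4_ord a6_ord by (auto intro!: R ord_local_ring)
    ultimately show ?thesis
      by (intro good_reduction_atI[of 1 _ 0 0 0 0 _ \<mu> _ 1 _ "- 12 * \<mu> ^ 2" _ "(- 67 * \<mu> ^ 3 - 1) / 4"] zK)
         (auto simp only: wdisc_twist insert_subset, simp_all)
  next
    case C
    \<comment> \<open>Otherwise the sum 74 x and the product 37 z^2 of the two conjugates lie in P.
      Since 2 and 37 do not, x and z would, although they are coprime.\<close>
    have \<mu>': "\<mu>' \<notin> P"
    proof
      assume "\<mu>' \<in> P"
      then have "2 * (37 * of_int x) \<in> P"
        using P_add[OF \<open>\<mu> \<in> P\<close>, of \<mu>'] by (simp add: \<mu>_def \<mu>'_def)
      then have x: "of_int x \<in> P"
        using P_prime[of 2 "37 * of_int x"] P_prime[of 37 "of_int x"] C two d_mod_4 by auto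
      have "37 * of_int z ^ 2 \<in> P"
        using P_mult[OF \<mu>'_ord \<open>\<mu> \<in> P\<close>] norm_\<mu> by (simp add: mult.commute)
      then have "of_int z \<in> P"
        using C P_prime[of 37 "of_int z ^ 2"] P_power[of "of_int z" 2] half_int_order_power[OF d_mod_4, of "of_int z" 2]
        by auto
      with x coprime_xz P_coprime_int show False by blast
    qed
    \<comment> \<open>Twisting by \<open>\<nu>\<close> instead of \<open>\<mu>\<close> changes the
      parameter by the square z^2, so the curve stays isomorphic; the norm equation shows that
      \<open>\<nu>\<close> is a unit at P.\<close>
    define \<nu> where "\<nu> = \<mu> / of_int z ^ 2"
    have \<nu>: "\<nu> = 37 / \<mu>'"
      using norm_\<mu> z_nonzero \<mu>'_nonzero unfolding \<nu>_def by (auto simp: field_simps)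
    have "\<nu> \<in> local_ring" unfolding \<nu> using \<mu>' \<mu>'_ord by (auto intro: local_ringI)
    have "inverse \<nu> \<in> local_ring" unfolding \<nu> using C \<mu>'_ord by (auto intro: local_ringI)
    have i37: "inverse 37 \<in> local_ring" and i2: "inverse 2 \<in> local_ring"
      using C two by (blast intro: inverse_local_ring numeral_half_int_order)+
    have "37 ^ 3 * \<nu> ^ 6 \<in> ?R" "inverse (37 ^ 3 * \<nu> ^ 6) \<in> ?R"
      unfolding inverse_mult_distrib power_inverse[symmetric]
      by (intro R local_ring_mult local_ring_power i37 \<open>\<nu> \<in> local_ring\<close> \<open>inverse \<nu> \<in> local_ring\<close> ord_local_ring numeral_half_int_order)+
    moreover have "- 12 * \<nu> ^ 2 \<in> ?R" "- 67 / 4 * \<nu> ^ 3 \<in> ?R" "\<nu> \<in> ?R" "0 \<in> ?R"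
    proof -
      have "of_int (-12) * \<nu> ^ 2 \<in> local_ring" "of_int (-67) * inverse 2 ^ 2 * \<nu> ^ 3 \<in> local_ring" "0 \<in> local_ring"
        by (intro local_ring_mult local_ring_power i2 \<open>\<nu> \<in> local_ring\<close> ord_local_ring of_int_half_int_order zero_half_int_order)+
      then show "- 12 * \<nu> ^ 2 \<in> ?R" "- 67 / 4 * \<nu> ^ 3 \<in> ?R" "\<nu> \<in> ?R" "0 \<in> ?R"
        using \<open>\<nu> \<in> local_ring\<close> by (auto intro!: R simp: power_divide inverse_eq_divide)
    qed
    ultimately have "{0, \<nu>, 0, - 12 * \<nu> ^ 2, - 67 / 4 * \<nu> ^ 3,
        wdisc 0 \<nu> 0 (- 12 * \<nu> ^ 2) (- 67 / 4 * \<nu> ^ 3),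
        inverse (wdisc 0 \<nu> 0 (- 12 * \<nu> ^ 2) (- 67 / 4 * \<nu> ^ 3))} \<subseteq> ?R"
      unfolding wdisc_short1 by blast
    moreover have "of_int z \<in> qfield d" using K[of "of_int z" 1] by auto
    moreover have "- 12 * \<nu> ^ 2 = - 12 * \<mu> ^ 2 / of_int z ^ 4"
      "- 67 / 4 * \<nu> ^ 3 = ((- 67 * \<mu> ^ 3 - 1) / 4 - (- 1 / 2) - (- 1 / 2) ^ 2) / of_int z ^ 6"
      using z_nonzero unfolding \<nu>_def by (auto simp: field_simps power_divide)
    ultimately show ?thesis
      using z_nonzero
      by (intro good_reduction_atI[of "of_int z" _ 0 0 "- 1 / 2" 0 _ \<nu> _ 0 _ "- 12 * \<nu> ^ 2" _ "- 67 / 4 * \<nu> ^ 3"] zK)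
         (simp_all add: \<nu>_def)
  next
    case B
    have z: "of_int z \<notin> P"
      using P_coprime_int[of z 37] B z_37 prime_imp_coprime[of 37 z] by (auto simp: coprime_commute)
    have n: "of_int n \<notin> P"
      using P_coprime_int[of n 37] B n_37 prime_imp_coprime[of 37 n] by (auto simp: coprime_commute)
    have three: "of_int 3 \<notin> P"
      using P_coprime_int[of 3 37] B prime_imp_coprime[of 37 "3::int"] by (auto simp: coprime_commute)
    have v: "v \<notin> P"
    proof
      assume "v \<in> P"
      then have "of_int z ^ 4 \<in> P"
        using P_mult[OF v'_ord \<open>v \<in> P\<close>] norm_v by (simp add: mult.commute)
      with z show False using P_power[of "of_int z" 4] by auto
    qed
    have v0: "v \<noteq> 0" using v P_zero by auto
    have w0: "w \<noteq> 0" using w_square n_pos by auto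
    have w4: "w ^ 4 = (37 * of_int n) ^ 2" and w6: "w ^ 6 = - ((37 * of_int n) ^ 3)"
      using w_square by Groebner_Basis.algebra+
    have \<mu>3: "\<mu> ^ 3 = 37 * v * \<mu>"
      using \<mu>_square by Groebner_Basis.algebra
    have i: "inverse (of_int 3) \<in> local_ring" "inverse 2 \<in> local_ring" "inverse (of_int n) \<in> local_ring"
      "inverse v \<in> local_ring" "v \<in> local_ring" "\<mu> \<in> local_ring" "of_int n \<in> local_ring"
      using B two three n v v_ord \<mu>_ord
      by (blast intro: inverse_local_ring ord_local_ring numeral_half_int_order of_int_half_int_order)+
    \<comment> \<open>Shifting x by -\<open>\<mu>\<close>/3 and y by -1/2 gives y^2 = x^3 - (37/3)
      \<open>\<mu>\<close>^2 x - (1369/108) \<open>\<mu>\<close>^3. Dividing the coefficients by w^4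
      and w^6 and using \<open>\<mu>\<close>^2 = 37 v cancels every factor 37 and leaves
      \<open>b4\<close> and \<open>b6\<close>. In the discriminant 64/27 - 37/27 = 1.\<close>
    define b4 where "b4 = - (inverse (of_int 3) * v * inverse (of_int n) ^ 2)"
    define b6 where "b6 = inverse 2 ^ 2 * inverse (of_int 3) ^ 3 * \<mu> * v * inverse (of_int n) ^ 3"
    have disc: "wdisc 0 0 0 b4 b6 = v ^ 3 * inverse (of_int n) ^ 6"
    proof -
      have "b6 ^ 2 = \<mu> ^ 2 * v ^ 2 / (11664 * of_int n ^ 6)"
        unfolding b6_def by (simp add: power_mult_distrib power_divide inverse_eq_divide)
      also have "\<dots> = 37 / 11664 * v ^ 3 / of_int n ^ 6"
        unfolding \<mu>_square by (simp add: power2_eq_square power3_eq_cube)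
      finally have "b6 ^ 2 = 37 / 11664 * v ^ 3 / of_int n ^ 6" .
      moreover have "b4 ^ 3 = - 1 / 27 * v ^ 3 / of_int n ^ 6"
        unfolding b4_def by (simp add: power_mult_distrib power_divide inverse_eq_divide)
      ultimately show ?thesis
        unfolding wdisc_short by (simp add: field_simps)
    qed
    have "wdisc 0 0 0 b4 b6 \<in> local_ring" "inverse (wdisc 0 0 0 b4 b6) \<in> local_ring"
      unfolding disc inverse_mult_distrib power_inverse[symmetric] inverse_inverse_eq
      by (intro local_ring_mult local_ring_power i)+
    moreover have "b4 \<in> local_ring" "b6 \<in> local_ring"
      unfolding b4_def b6_def by (intro local_ring_mult local_ring_power local_ring_uminus i)+
    moreover have "0 \<in> local_ring" by (auto intro: ord_local_ring)
    ultimately have "{0, 0, 0, b4, b6, wdisc 0 0 0 b4 b6, inverse (wdisc 0 0 0 b4 b6)} \<subseteq> ?R"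
      using R by auto
    moreover have "w \<in> qfield d" "- \<mu> / 3 \<in> qfield d"
      using K[OF w_ord, of 1] K[OF \<mu>_ord, of "- 1 / 3"] by auto
    moreover have "b4 = (- 12 * \<mu> ^ 2 - 0 * 1 + 2 * (- \<mu> / 3) * \<mu> - (- 1 / 2 + - \<mu> / 3 * 0) * 0
        + 3 * (- \<mu> / 3) ^ 2 - 2 * 0 * (- 1 / 2)) / w ^ 4"
      using n_pos unfolding b4_def w4 by (simp add: power_divide \<mu>_square power2_eq_square[of \<mu>, symmetric] field_simps)
    moreover have "b6 = ((- 67 * \<mu> ^ 3 - 1) / 4 + - \<mu> / 3 * (- 12 * \<mu> ^ 2) + (- \<mu> / 3) ^ 2 * \<mu>
        + (- \<mu> / 3) ^ 3 - (- 1 / 2) * 1 - (- 1 / 2) ^ 2 - - \<mu> / 3 * (- 1 / 2) * 0) / w ^ 6"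
    proof -
      have "(- 67 * \<mu> ^ 3 - 1) / 4 + - \<mu> / 3 * (- 12 * \<mu> ^ 2) + (- \<mu> / 3) ^ 2 * \<mu>
        + (- \<mu> / 3) ^ 3 - (- 1 / 2) * 1 - (- 1 / 2) ^ 2 - - \<mu> / 3 * (- 1 / 2) * 0 = - 1369 / 108 * \<mu> ^ 3"
        by (simp add: field_simps power2_eq_square power3_eq_cube)
      then show ?thesis
        using n_pos unfolding b6_def w6 \<mu>3 by (simp add: field_simps)
    qed
    ultimately show ?thesis
      using w0
      by (intro good_reduction_atI[of w _ "- \<mu> / 3" 0 "- 1 / 2" 0 _ 0 _ 0 _ b4 _ b6] zK) auto
  qed
qed

lemma everywhere_good_reduction:
  "everywhere_good_reduction (qfield d) 0 \<mu> 1 (- 12 * \<mu> ^ 2) ((- 67 * \<mu> ^ 3 - 1) / 4)"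
  unfolding everywhere_good_reduction_def using good_reduction by blast

end

section \<open>Norms from \<open>Q(\<surd>37)\<close>\<close>

text \<open>That n is the norm of (a + b sqrt 37) / c, with denominators cleared so that the
  argument stays within the integers.\<close>

definition norm37 :: "int \<Rightarrow> bool" where
  "norm37 n \<longleftrightarrow> (\<exists>a b c. c \<noteq> 0 \<and> a ^ 2 - 37 * b ^ 2 = n * c ^ 2)"

lemma norm37I: "c \<noteq> 0 \<Longrightarrow> a ^ 2 - 37 * b ^ 2 = n * c ^ 2 \<Longrightarrow> norm37 n"
  unfolding norm37_def by blast

lemma norm37_mult: "norm37 m \<Longrightarrow> norm37 n \<Longrightarrow> norm37 (m * n)"
proof -
  assume "norm37 m" "norm37 n"
  then obtain a b c a' b' c' where *: "c \<noteq> 0" "a ^ 2 - 37 * b ^ 2 = m * c ^ 2"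
    "c' \<noteq> 0" "a' ^ 2 - 37 * b' ^ 2 = n * c' ^ 2"
    unfolding norm37_def by blast
  have "(a * a' + 37 * b * b') ^ 2 - 37 * (a * b' + a' * b) ^ 2
      = (a ^ 2 - 37 * b ^ 2) * (a' ^ 2 - 37 * b' ^ 2)"
    by (simp add: power2_eq_square algebra_simps)
  also have "\<dots> = m * n * (c * c') ^ 2"
    unfolding * by (simp add: power2_eq_square)
  finally show ?thesis using * by (intro norm37I[of "c * c'"]) auto
qed

text \<open>Multiplying by k once more makes k^2 n a norm, and the square k^2 is absorbed by the
  denominator.\<close>

lemma norm37_cancel: "norm37 (k * n) \<Longrightarrow> norm37 k \<Longrightarrow> k \<noteq> 0 \<Longrightarrow> norm37 n"
proof -
  assume "norm37 (k * n)" "norm37 k" and k: "k \<noteq> 0"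
  then have "norm37 (k * (k * n))" using norm37_mult by blast
  then obtain a b c where "c \<noteq> 0" "a ^ 2 - 37 * b ^ 2 = k * (k * n) * c ^ 2"
    unfolding norm37_def by blast
  then have "k * c \<noteq> 0" "a ^ 2 - 37 * b ^ 2 = n * (k * c) ^ 2"
    using k by (simp_all add: power_mult_distrib power2_eq_square[of k] mult_ac)
  then show ?thesis by (rule norm37I)
qed

text \<open>The unit 6 + sqrt 37 has norm -1.\<close>

lemma norm37_minus_1: "norm37 (-1)"
  by (rule norm37I[of 1 6 1]) auto

lemma norm37_1: "norm37 1"
  by (rule norm37I[of 1 1 0]) auto

text \<open>The element (7 + sqrt 37) / 2 has norm 3.\<close>

lemma norm37_3: "norm37 3"
  by (rule norm37I[of 2 7 1]) auto

lemma norm37_4: "norm37 4"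
  by (rule norm37I[of 1 2 0]) auto

lemma norm37_uminus: "norm37 n \<Longrightarrow> norm37 (- n)"
  using norm37_mult[OF norm37_minus_1, of n] by simp

lemma norm37_prod: "(\<And>p. p \<in> A \<Longrightarrow> norm37 (f p)) \<Longrightarrow> norm37 (prod f A)"
  by (induction A rule: infinite_finite_induct) (auto intro: norm37_1 norm37_mult)

text \<open>The multiplicity of 37 would be even on the left and odd on the right. This excludes a
  zero norm in the Thue argument.\<close>

lemma square_eq_37_square: "(a::int) ^ 2 = 37 * b ^ 2 \<Longrightarrow> b = 0"
proof (rule ccontr)
  assume eq: "a ^ 2 = 37 * b ^ 2" and b: "b \<noteq> 0"
  then have a: "a \<noteq> 0" by auto
  have p: "prime (37::int)" by simp
  have "2 * multiplicity 37 a = multiplicity 37 (37 * b ^ 2)"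
    using p a by (simp add: eq[symmetric] prime_elem_multiplicity_power_distrib)
  also have "\<dots> = 1 + 2 * multiplicity 37 b"
    using p b by (simp add: prime_elem_multiplicity_mult_distrib prime_elem_multiplicity_power_distrib)
  finally show False by presburger
qed

lemma norm_form_mod: "((a::int) ^ 2 - 37 * b ^ 2) mod m = (a ^ 2 mod m - 37 * (b ^ 2 mod m)) mod m"
  by (metis mod_diff_left_eq mod_diff_right_eq mod_mult_right_eq)

lemma square_mod_4: "(a::int) ^ 2 mod 4 = (if even a then 0 else 1)"
proof -
  have "a mod 4 \<in> {0, 1, 2, 3}" by auto
  then have "(a mod 4) ^ 2 mod 4 = (if even a then 0 else 1)"
    by (auto; presburger)
  then show ?thesis by (simp add: power_mod)
qed

lemma odd_square_mod_8: "odd (a::int) \<Longrightarrow> a ^ 2 mod 8 = 1"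
proof -
  assume "odd a"
  then have "a mod 8 \<in> {1, 3, 5, 7}" by (auto; presburger)
  then have "(a mod 8) ^ 2 mod 8 = 1" by auto
  then show ?thesis by (simp add: power_mod)
qed

text \<open>The box is chosen so that \<open>(A + 1) (B + 1) > p\<close>, while both \<open>A\<^sup>2\<close> and \<open>37 B\<^sup>2\<close>
  stay below \<open>7 p\<close>.\<close>
lemma small_norm_multiple:
  fixes p :: nat
  assumes p: "prime p" and qr: "QuadRes p 37"
  obtains x y k :: int where "x ^ 2 - 37 * y ^ 2 = k * p" "k \<noteq> 0" "\<bar>k\<bar> \<le> 6"
proof -
  obtain r where r: "[r ^ 2 = 37] (mod int p)" using qr unfolding QuadRes_def by blast
  define A B where "A = floor_sqrt (6 * p)" and "B = floor_sqrt (p div 6)"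
  have p0: "p > 0" using p prime_gt_0_nat by blast
  have "p * p < (Suc A * Suc B) ^ 2"
  proof -
    have "6 * p < (Suc A) ^ 2" "p div 6 < (Suc B) ^ 2"
      unfolding A_def B_def by (rule Suc_floor_sqrt_power2_gt)+
    then have "6 * p < (Suc A) ^ 2" "p < 6 * (Suc B) ^ 2" by linarith+
    then have "(6 * p) * p < (Suc A) ^ 2 * (6 * (Suc B) ^ 2)"
      by (intro mult_strict_mono) auto
    then have "p * p < (Suc A) ^ 2 * (Suc B) ^ 2" by simp
    then show ?thesis unfolding power_mult_distrib .
  qed
  then have AB: "p < Suc A * Suc B"
    by (metis power2_eq_square power_less_imp_less_base zero_le)
  \<comment> \<open>Thue's argument: the box has more than p points, so two of them share the
    residue of a - r b. Their difference (x, y) satisfies x = r y modulo p, hence x^2 = 37 y^2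
    modulo p.\<close>
  define D where "D = {0..int A} \<times> {0..int B}"
  define f where "f = (\<lambda>(a, b). (a - r * b) mod int p)"
  have "f ` D \<subseteq> {0..<int p}" using p0 unfolding f_def by auto
  then have "card (f ` D) \<le> card {0..<int p}" by (intro card_mono) auto
  also have "\<dots> = p" by simp
  also have "\<dots> < card D" using AB unfolding D_def by (simp add: card_cartesian_product nat_add_distrib)
  finally have "\<not> inj_on f D" by (rule pigeonhole)
  then obtain a b a' b' where ab: "(a, b) \<in> D" "(a', b') \<in> D" "(a, b) \<noteq> (a', b')" "f (a, b) = f (a', b')"
    unfolding inj_on_def by auto
  define x y where "x = a - a'" and "y = b - b'"
  have "[a - r * b = a' - r * b'] (mod int p)"
    using ab unfolding f_def cong_def by simp
  then have "int p dvd x - r * y"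
    unfolding cong_iff_dvd_diff x_def y_def by (simp add: algebra_simps)
  moreover have "int p dvd r ^ 2 - 37" using r unfolding cong_iff_dvd_diff .
  ultimately have "int p dvd (x - r * y) * (x + r * y) + (r ^ 2 - 37) * y ^ 2"
    by (intro dvd_add dvd_mult2)
  also have "(x - r * y) * (x + r * y) + (r ^ 2 - 37) * y ^ 2 = x ^ 2 - 37 * y ^ 2"
    by (simp add: power2_eq_square algebra_simps)
  finally obtain k where k: "x ^ 2 - 37 * y ^ 2 = k * int p" by (metis dvdE mult.commute)
  have "\<bar>x\<bar> \<le> int A" "\<bar>y\<bar> \<le> int B" using ab unfolding D_def x_def y_def by auto
  then have "x ^ 2 \<le> int A ^ 2" "y ^ 2 \<le> int B ^ 2"
    by (metis abs_ge_zero power2_abs power_mono)+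
  moreover have "int A ^ 2 \<le> 6 * int p" "int B ^ 2 \<le> int (p div 6)"
    unfolding A_def B_def by (metis floor_sqrt_power2_le of_nat_le_iff of_nat_power of_nat_mult of_nat_numeral)+
  ultimately have "x ^ 2 \<le> 6 * int p" "6 * y ^ 2 \<le> int p" by linarith+
  \<comment> \<open>From 0 \<le> x^2 \<le> 6 p and 0 \<le> 37 y^2 \<le> 37 p / 6 the quotient k lies
    between -37/6 and 6.\<close>
  then have "6 * (k * int p) \<le> 36 * int p" "- 37 * int p \<le> 6 * (k * int p)"
    using k zero_le_power2[of x] zero_le_power2[of y] by linarith+
  then have "int p * (6 * k) \<le> int p * 36" "int p * (- 37) \<le> int p * (6 * k)" by (simp_all add: algebra_simps)
  then have "6 * k \<le> 36" "- 37 \<le> 6 * k" using p0 by (simp_all only: mult_le_cancel_left_pos of_nat_0_less_iff)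
  then have "\<bar>k\<bar> \<le> 6" by linarith
  moreover have "k \<noteq> 0"
  proof
    assume "k = 0"
    with k have "x ^ 2 = 37 * y ^ 2" by simp
    with square_eq_37_square have "y = 0" "x = 0" by fastforce+
    with ab(3) show False unfolding x_def y_def by simp
  qed
  ultimately show ?thesis using that k by blast
qed

text \<open>Of the multiples k p with 0 < |k| \<le> 6, those with k = 2 modulo 4 are impossible
  because p is odd and a^2 - 37 b^2 is never 2 modulo 4. If 5 divided k, then 5 would divide x and
  y, since 37 is a nonresidue modulo 5; so 25 would divide 5 p. The remaining k, up to sign 1, 3 and
  4, are norms and can be cancelled.\<close>

lemma norm37_prime:
  fixes p :: nat
  assumes p: "prime p" and qr: "QuadRes p 37" and "p \<noteq> 2" "p \<noteq> 5"
  shows "norm37 (int p)"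
proof -
  obtain x y k :: int where k: "x ^ 2 - 37 * y ^ 2 = k * p" "k \<noteq> 0" "\<bar>k\<bar> \<le> 6"
    using small_norm_multiple[OF p qr] by blast
  have pint: "prime (int p)" using p by simp
  have "odd p" using p \<open>p \<noteq> 2\<close> prime_odd_nat[of p] prime_ge_2_nat[of p] by auto
  have mod4: "(k * p) mod 4 \<noteq> 2"
  proof -
    show ?thesis unfolding k(1)[symmetric] norm_form_mod[of x y] square_mod_4 by (auto split: if_splits)
  qed
  have not5: "k \<noteq> 5" "k \<noteq> -5"
  proof -
    have "k mod 5 \<noteq> 0"
    proof
      assume k5: "k mod 5 = 0"
      then have "5 dvd x ^ 2 - 37 * y ^ 2" unfolding k by auto
      then have *: "(x ^ 2 - 37 * y ^ 2) mod 5 = 0" by simp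
      have "(x ^ 2 - 37 * y ^ 2) mod 5 = ((x mod 5) ^ 2 - 37 * (y mod 5) ^ 2) mod 5"
        by (metis norm_form_mod power_mod)
      with * have **: "((x mod 5) ^ 2 - 37 * (y mod 5) ^ 2) mod 5 = 0" by simp
      have "x mod 5 \<in> {0, 1, 2, 3, 4}" "y mod 5 \<in> {0, 1, 2, 3, 4}" by auto
      with ** have "x mod 5 = 0" "y mod 5 = 0" by auto
      then obtain x' y' where xy: "x = 5 * x'" "y = 5 * y'" by (auto elim!: dvdE)
      have "k = 5 \<or> k = - 5" using k5 k by presburger
      then have "int p = 5 * (x' ^ 2 - 37 * y' ^ 2) \<or> int p = 5 * (37 * y' ^ 2 - x' ^ 2)"
        using k unfolding xy by (auto simp: power2_eq_square algebra_simps)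
      then have "5 dvd int p" by (metis dvd_triv_left)
      then have "5 dvd p" by presburger
      with p \<open>p \<noteq> 5\<close> show False by (metis prime_nat_iff numeral_eq_one_iff semiring_norm(86) One_nat_def)
    qed
    then show "k \<noteq> 5" "k \<noteq> -5" by auto
  qed
  have "k \<notin> {2, 6, -2, -6}"
  proof
    assume "k \<in> {2, 6, -2, -6}"
    moreover from \<open>odd p\<close> have "int p mod 4 = 1 \<or> int p mod 4 = 3" by presburger
    ultimately have "(k * p) mod 4 = 2"
      by (auto; presburger)
    with mod4 show False by contradiction
  qed
  moreover have "- 6 \<le> k" "k \<le> 6" using k(3) by linarith+
  ultimately have "k = 1 \<or> k = 3 \<or> k = 4 \<or> k = -1 \<or> k = -3 \<or> k = -4"
    using k(2) not5 by (simp; presburger)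
  then have "norm37 k"
    using norm37_1 norm37_3 norm37_4 norm37_uminus by auto
  moreover have "norm37 (k * p)" using k by (intro norm37I[of 1 x y]) auto
  ultimately show ?thesis using norm37_cancel \<open>k \<noteq> 0\<close> by blast
qed

section \<open>From norms to primitive points on the conic\<close>

lemma squarefree_square_dvd_mult_square:
  fixes g m c :: int
  assumes "squarefree m" "g ^ 2 dvd m * c ^ 2" "c \<noteq> 0"
  shows "g dvd c"
proof -
  have m: "m \<noteq> 0" using assms by auto
  have g: "g \<noteq> 0" using assms m by auto
  show ?thesis
  proof (rule multiplicity_le_imp_dvd[OF g])
    fix p :: int assume p: "prime p"
    have "multiplicity p (g ^ 2) \<le> multiplicity p (m * c ^ 2)"
      using assms m by (intro dvd_imp_multiplicity_le) auto
    then have "2 * multiplicity p g \<le> multiplicity p m + 2 * multiplicity p c"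
      using prime_imp_prime_elem[OF p] g m assms by (simp add: prime_elem_multiplicity_mult_distrib prime_elem_multiplicity_power_distrib)
    \<comment> \<open>The inequality 2 v(g) \<le> 1 + 2 v(c) between integers forces v(g) \<le>
      v(c).\<close>
    moreover have "multiplicity p m \<le> 1"
      using assms p m squarefree_factorial_semiring'[OF m] 
      by (metis One_nat_def not_dvd_imp_multiplicity_0 order.refl prime_factorsI zero_le_one)
    ultimately show "multiplicity p g \<le> multiplicity p c" by linarith
  qed
qed

text \<open>The square of gcd(a, b) divides m c^2. As m is squarefree, the gcd divides c, and the
  whole equation can be scaled down.\<close>

lemma norm37_primitive:
  fixes a b c m :: int
  assumes "squarefree m" "a ^ 2 - 37 * b ^ 2 = m * c ^ 2" "c \<noteq> 0"
  obtains g a' b' c' where "a = g * a'" "b = g * b'" "c = g * c'" "coprime a' b'"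
    "a' ^ 2 - 37 * b' ^ 2 = m * c' ^ 2" "c' \<noteq> 0"
proof -
  define g where "g = gcd a b"
  have ab: "a \<noteq> 0 \<or> b \<noteq> 0" using assms by auto
  obtain a' b' where *: "a = g * a'" "b = g * b'" "coprime a' b'"
    using gcd_coprime_exists[of a b] ab unfolding g_def by (auto simp: mult.commute)
  have "g ^ 2 dvd m * c ^ 2"
    unfolding assms(2)[symmetric] * by (simp add: power_mult_distrib)
  then have "g dvd c" using squarefree_square_dvd_mult_square assms by blast
  then obtain c' where c: "c = g * c'" by blast
  have g: "g \<noteq> 0" using ab * by auto
  have "g ^ 2 * (a' ^ 2 - 37 * b' ^ 2) = g ^ 2 * (m * c' ^ 2)"
    using assms(2) unfolding * c by (simp add: power_mult_distrib right_diff_distrib mult.left_commute)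
  with g have "a' ^ 2 - 37 * b' ^ 2 = m * c' ^ 2" by simp
  with that * c assms show ?thesis by auto
qed

text \<open>The conic needs a representation of m with even denominator c = 2 y. If c is odd, then m
  = 3 modulo 4 forces a even and b odd, and multiplying by an element of norm 1 with even
  denominator repairs this. Afterwards z = a, and x is b up to sign.\<close>

lemma norm37_conic_point:
  assumes m: "squarefree m" "norm37 m" "m > 0" "m mod 4 = 3" "\<not> 37 dvd m"
  shows "\<exists>x y z. conic_point m x y z"
proof -
  have "\<exists>a b c. c \<noteq> 0 \<and> a ^ 2 - 37 * b ^ 2 = m * c ^ 2 \<and> coprime a b \<and> even c"
  proof -
    obtain a0 b0 c0 where 0: "c0 \<noteq> 0" "a0 ^ 2 - 37 * b0 ^ 2 = m * c0 ^ 2"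
      using m unfolding norm37_def by blast
    obtain g a b c where 1: "a0 = g * a" "b0 = g * b" "c0 = g * c" "coprime a b"
      "a ^ 2 - 37 * b ^ 2 = m * c ^ 2" "c \<noteq> 0"
      using norm37_primitive[OF m(1) 0(2,1)] by blast
    show ?thesis
    proof (cases "even c")
      case True
      with 1 show ?thesis by blast
    next
      case False
      have "(a ^ 2 mod 4 - 37 * (b ^ 2 mod 4)) mod 4 = ((m mod 4) * (c ^ 2 mod 4)) mod 4"
        by (metis 1(5) norm_form_mod mod_mult_eq)
      with m False have "even a" "odd b" unfolding square_mod_4 by (auto split: if_splits)
      \<comment> \<open>multiplication by \<open>(43 + 7 \<surd>37) / 6\<close>, which has norm 1\<close>
      have "(43 * a + 259 * b) ^ 2 - 37 * (7 * a + 43 * b) ^ 2 = 36 * (a ^ 2 - 37 * b ^ 2)"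
        by (simp add: power2_eq_square algebra_simps)
      also have "\<dots> = m * (6 * c) ^ 2" unfolding 1 by (simp add: power_mult_distrib)
      finally have "(43 * a + 259 * b) ^ 2 - 37 * (7 * a + 43 * b) ^ 2 = m * (6 * c) ^ 2" .
      moreover have "6 * c \<noteq> 0" using 1(6) by simp
      ultimately obtain h a' b' c' where 2: "43 * a + 259 * b = h * a'" "7 * a + 43 * b = h * b'" "6 * c = h * c'"
        "coprime a' b'" "a' ^ 2 - 37 * b' ^ 2 = m * c' ^ 2" "c' \<noteq> 0"
        using norm37_primitive[OF m(1)] by blast
      \<comment> \<open>7 a + 43 b is odd, so only an odd factor is removed, and the factor 2 of 6 c
        survives in c'.\<close>
      have "odd h" using 2(2) \<open>even a\<close> \<open>odd b\<close> by (metis even_add even_mult_iff odd_numeral)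
      moreover have "even (h * c')" unfolding 2(3)[symmetric] by simp
      ultimately have "even c'" by simp
      with 2 show ?thesis by blast
    qed
  qed
  then obtain a b c where abc: "a ^ 2 - 37 * b ^ 2 = m * c ^ 2" "coprime a b" "even c" by blast
  then obtain y where c: "c = 2 * y" by blast
  have "(a ^ 2 mod 4 - 37 * (b ^ 2 mod 4)) mod 4 = (m * (c ^ 2 mod 4)) mod 4"
    by (metis abc(1) norm_form_mod mod_mult_right_eq)
  then have "even a \<longleftrightarrow> even b" using abc(3) unfolding square_mod_4 by (auto split: if_splits)
  then have odd: "odd a" "odd b" using abc(2) by (auto dest: not_coprimeI[of 2 a b])
  have "(a ^ 2 mod 8 - 37 * (b ^ 2 mod 8)) mod 8 = (4 * m * y ^ 2) mod 8"
    unfolding norm_form_mod[symmetric] abc(1) c by (simp add: power_mult_distrib mult_ac)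
  \<comment> \<open>For odd a and b the left side is 1 - 37 modulo 8, that is 4; so y cannot be
    even.\<close>
  then have 8: "(4 * m * y ^ 2) mod 8 = 4" using odd by (simp add: odd_square_mod_8)
  have y: "odd y"
  proof
    assume "even y"
    then obtain y' where "y = 2 * y'" by blast
    with 8 show False by (simp add: power_mult_distrib mod_mult_right_eq)
  qed
  \<comment> \<open>The sign of x is free in the conic, and an odd b or its negative is 3 modulo
    4.\<close>
  define x where "x = (if b mod 4 = 3 then b else - b)"
  have "x mod 4 = 3" using odd unfolding x_def by presburger
  moreover have "coprime x a" using abc(2) unfolding x_def by (auto simp: coprime_commute)
  moreover have "a ^ 2 = 37 * x ^ 2 + 4 * m * y ^ 2"
    using abc(1) unfolding c x_def by (auto simp: power_mult_distrib algebra_simps)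
  ultimately have "conic_point m x y a"
    using m y by unfold_locales auto
  then show ?thesis by blast
qed

section \<open>Estimates of Chebyshev and Mertens\<close>

text \<open>Both sides run over the pairs (d, m) with d m \<le> N.\<close>

lemma sum_divisors_swap:
  fixes g :: "nat \<Rightarrow> nat \<Rightarrow> 'a :: comm_monoid_add"
  shows "(\<Sum>n=1..N. \<Sum>d | d dvd n. g d (n div d)) = (\<Sum>d=1..N. \<Sum>m=1..N div d. g d m)"
proof -
  have "(\<Sum>n=1..N. \<Sum>d | d dvd n. g d (n div d))
      = (\<Sum>(n, d)\<in>(SIGMA n:{1..N}. {d. d dvd n}). g d (n div d))"
    by (rule sum.Sigma) auto
  also have "\<dots> = (\<Sum>(d, m)\<in>(SIGMA d:{1..N}. {1..N div d}). g d m)"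
    by (rule sum.reindex_bij_witness[of _ "\<lambda>(d, m). (d * m, d)" "\<lambda>(n, d). (d, n div d)"])
       (auto simp: Suc_le_eq div_greater_zero_iff less_eq_div_iff_mult_less_eq mult.commute
             elim!: dvdE, erule order.trans[rotated], simp)
  also have "\<dots> = (\<Sum>d=1..N. \<Sum>m=1..N div d. g d m)"
    by (rule sum.Sigma[symmetric]) auto
  finally show ?thesis .
qed

lemma real_nat_div_le: "real (N div d) \<le> real N / real d"
  and real_nat_div_gt: "real N / real d < real (N div d) + 1"
proof -
  have "real N = real d * real (N div d) + real (N mod d)"
    by (metis mult_div_mod_eq of_nat_add of_nat_mult)
  moreover have "d > 0 \<Longrightarrow> real (N mod d) < real d" by simp
  ultimately have "d > 0 \<Longrightarrow> real (N div d) \<le> real N / real d \<and> real N / real d < real (N div d) + 1"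
    by (simp add: field_simps)
  then show "real (N div d) \<le> real N / real d" "real N / real d < real (N div d) + 1"
    by (cases "d = 0"; simp)+
qed

lemma ln_Suc_diff_le:
  assumes "n > 0"
  shows "ln (real (Suc n)) - ln (real n) \<le> 1 / real n"
proof -
  have "ln (real (Suc n)) - ln (real n) = ln (real (Suc n) / real n)"
    using assms by (simp add: ln_div)
  also have "real (Suc n) / real n = 1 + 1 / real n"
    using assms by (simp add: field_simps)
  also have "ln (1 + 1 / real n) \<le> 1 / real n" by (rule ln_add_one_self_le_self) auto
  finally show ?thesis .
qed

text \<open>Write ln n as the sum of \<open>mangoldt\<close> over the divisors of n; each d has N
  div d multiples up to N.\<close>

lemma ln_fact_eq_sum_mangoldt: "ln (fact N) = (\<Sum>d=1..N. mangoldt d * real (N div d))"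
proof -
  have "ln (fact N) = (\<Sum>n=1..N. ln (real n))"
    unfolding fact_prod of_nat_prod by (subst ln_prod) auto
  also have "\<dots> = (\<Sum>n=1..N. \<Sum>d | d dvd n. mangoldt d)"
    by (intro sum.cong) (auto simp: mangoldt_sum)
  also have "\<dots> = (\<Sum>d=1..N. mangoldt d * real (N div d))"
    by (subst sum_divisors_swap) (simp add: mult.commute)
  finally show ?thesis .
qed

lemma ln_fact_le: "ln (fact N) \<le> N * ln (real N)"
proof (cases "N = 0")
  case False
  have "ln (fact N) \<le> ln (real (N ^ N))"
    using fact_le_power[of N, where ?'a = real] False by (subst ln_le_cancel_iff) auto
  then show ?thesis using False by (simp add: ln_realpow)
qed auto

lemma ln_fact_ge: "ln (fact N) \<ge> N * ln (real N) - N"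
proof (induction N)
  case (Suc N)
  show ?case
  proof (cases "N = 0")
    case False
    have "N * (ln (real (Suc N)) - ln (real N)) \<le> 1"
      using ln_Suc_diff_le[of N] False by (simp add: field_simps)
    moreover have "ln (fact (Suc N)) = ln (real (Suc N)) + ln (fact N)"
      by (simp add: ln_mult)
    ultimately show ?thesis using Suc by (simp add: algebra_simps)
  qed auto
qed auto

text \<open>Chebyshev's argument with k = N div 2: the coefficient N div d - 2 (k div d) is 0 or 1,
  and it is 1 for k < d \<le> N. Hence the sum over (k, N] is at most ln N! - 2 ln k!, which is at
  most 2 N, and 4 k + 2 N \<le> 4 N closes the induction.\<close>

lemma sum_mangoldt_le: "(\<Sum>d=1..N. mangoldt d) \<le> 4 * real N"
proof (induction N rule: less_induct)
  case (less N)
  show ?case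
  proof (cases "N = 0")
    case False
    define k where "k = N div 2"
    have kN: "k < N" "k \<le> N" using False unfolding k_def by auto
    have "(\<Sum>d=1..N. mangoldt d) - (\<Sum>d=1..k. mangoldt d) = (\<Sum>d\<in>{1..N}-{1..k}. mangoldt d :: real)"
      using kN by (subst sum_diff) auto
    also have "\<dots> \<le> (\<Sum>d\<in>{1..N}-{1..k}. mangoldt d * real (N div d mod 2))"
    proof (intro sum_mono)
      fix d assume "d \<in> {1..N} - {1..k}"
      then have "N div d = 1"
        unfolding k_def by (intro div_nat_eqI) auto
      then show "mangoldt d \<le> mangoldt d * real (N div d mod 2)" by simp
    qed
    also have "\<dots> \<le> (\<Sum>d=1..N. mangoldt d * real (N div d mod 2))"
      by (intro sum_mono2) (auto intro!: mult_nonneg_nonneg mangoldt_nonneg)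
    also have "\<dots> = (\<Sum>d=1..N. mangoldt d * real (N div d) - 2 * (mangoldt d * real (k div d)))"
    proof (intro sum.cong refl)
      fix d
      have "k div d = N div d div 2"
        unfolding k_def by (metis div_mult2_eq mult.commute)
      then have "N div d = N div d mod 2 + 2 * (k div d)" by presburger
      then have "real (N div d) = real (N div d mod 2) + 2 * real (k div d)"
        by (metis of_nat_add of_nat_mult of_nat_numeral)
      then show "mangoldt d * real (N div d mod 2) = mangoldt d * real (N div d) - 2 * (mangoldt d * real (k div d))"
        by (simp add: algebra_simps)
    qed
    also have "\<dots> = ln (fact N) - 2 * (\<Sum>d=1..N. mangoldt d * real (k div d))"
      by (simp add: ln_fact_eq_sum_mangoldt sum_subtractf sum_distrib_left)
    also have "(\<Sum>d=1..N. mangoldt d * real (k div d)) = (\<Sum>d=1..k. mangoldt d * real (k div d))"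
      using kN by (intro sum.mono_neutral_right) auto
    also have "\<dots> = ln (fact k)" by (rule ln_fact_eq_sum_mangoldt[symmetric])
    also have "ln (fact N) - 2 * ln (fact k) \<le> 2 * real N"
    proof -
      \<comment> \<open>For odd N the complement of k is k + 1. The resulting factor
        \<open>Suc k\<close> is absorbed in a second power of 2 beside the bound for the binomial
        coefficient.\<close>
      have "N - k \<le> Suc k" unfolding k_def by auto
      then have "(fact (N - k) :: nat) \<le> fact (Suc k)" by (rule fact_mono_nat)
      have "(fact N :: nat) = fact k * fact (N - k) * (N choose k)"
        using kN binomial_fact_lemma by metis
      also have "\<dots> \<le> fact k * fact (Suc k) * 2 ^ N"
        using \<open>fact (N - k) \<le> fact (Suc k)\<close> by (intro mult_mono binomial_le_pow2) auto
      also have "\<dots> = fact k ^ 2 * (Suc k * 2 ^ N)" by (simp add: power2_eq_square algebra_simps)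
      also have "Suc k \<le> 2 ^ N"
        using kN less_exp[of N] by linarith
      finally have "(fact N :: nat) \<le> fact k ^ 2 * (2 ^ N * 2 ^ N)" by simp
      then have "real (fact N) \<le> real (fact k ^ 2 * (2 ^ N * 2 ^ N))"
        unfolding of_nat_le_iff .
      then have "(fact N :: real) \<le> fact k ^ 2 * (2 ^ N * 2 ^ N)" by simp
      then have "ln (fact N) \<le> ln (fact k ^ 2 * (2 ^ N * 2 ^ N) :: real)"
        by (subst ln_le_cancel_iff) auto
      also have "\<dots> = 2 * ln (fact k) + 2 * (real N * ln 2)"
        by (simp add: ln_mult ln_realpow)
      also have "\<dots> \<le> 2 * ln (fact k) + 2 * (real N * 1)"
        using ln_2_less_1 by (intro add_left_mono mult_left_mono) auto
      finally show ?thesis by simp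
    qed
    finally have "(\<Sum>d=1..N. mangoldt d) \<le> (\<Sum>d=1..k. mangoldt d) + 2 * real N" by simp
    also have "(\<Sum>d=1..k. mangoldt d) \<le> 4 * real k" using less kN by auto
    also have "4 * real k + 2 * real N \<le> 4 * real N" unfolding k_def by linarith
    finally show ?thesis by simp
  qed auto
qed

text \<open>Replacing N div d by N / d in the formula for ln N! costs at most the sum of
  \<open>mangoldt\<close>, which is at most 4 N; the bounds on ln N! then give both inequalities
  after division by N.\<close>

lemma sum_mangoldt_over_n:
  assumes "N > 0"
  shows "\<bar>(\<Sum>d=1..N. mangoldt d / real d) - ln (real N)\<bar> \<le> 4"
proof -
  let ?M = "\<Sum>d=1..N. mangoldt d / real d"
  have "N * ln (real N) - N \<le> ln (fact N)" by (rule ln_fact_ge)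
  also have "\<dots> \<le> (\<Sum>d=1..N. mangoldt d * (real N / real d))"
    unfolding ln_fact_eq_sum_mangoldt
    by (intro sum_mono mult_left_mono mangoldt_nonneg real_nat_div_le)
  also have "\<dots> = N * ?M" by (simp add: sum_distrib_left mult_ac)
  finally have "real N * (ln (real N) - 1) \<le> real N * ?M" by (simp add: algebra_simps)
  then have 1: "ln (real N) - 1 \<le> ?M" using assms by simp
  have "N * ?M = (\<Sum>d=1..N. mangoldt d * (real N / real d))" by (simp add: sum_distrib_left mult_ac)
  also have "\<dots> \<le> (\<Sum>d=1..N. mangoldt d * (real (N div d) + 1))"
  proof (intro sum_mono mult_left_mono mangoldt_nonneg)
    fix d show "real N / real d \<le> real (N div d) + 1"
      using real_nat_div_gt[of N d] by linarith
  qed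
  also have "\<dots> = ln (fact N) + (\<Sum>d=1..N. mangoldt d)"
    unfolding ln_fact_eq_sum_mangoldt by (simp add: distrib_left sum.distrib)
  also have "\<dots> \<le> N * ln (real N) + 4 * real N"
    by (intro add_mono ln_fact_le sum_mangoldt_le)
  finally have "real N * ?M \<le> real N * (ln (real N) + 4)" by (simp add: algebra_simps)
  then have "?M \<le> ln (real N) + 4" using assms by simp
  with 1 show ?thesis by linarith
qed

lemma sum_Abel_bound:
  fixes a f :: "nat \<Rightarrow> real"
  assumes a: "\<And>k. \<bar>\<Sum>n=M..<k. a n\<bar> \<le> B"
    and f: "\<And>n. n \<ge> M \<Longrightarrow> f (Suc n) \<le> f n" "\<And>n. n \<ge> M \<Longrightarrow> 0 \<le> f n"
  shows "\<bar>\<Sum>n=M..<k. a n * f n\<bar> \<le> B * f M"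
proof (cases "k \<ge> M")
  case True
  define A where "A k = (\<Sum>n=M..<k. a n)" for k
  \<comment> \<open>The boundary term of the summation by parts is kept on the left, so that the
    remaining bound telescopes.\<close>
  have "\<bar>(\<Sum>n=M..<k. a n * f n) - A k * f k\<bar> \<le> B * (f M - f k)"
    using True
  proof (induction k rule: dec_induct)
    case base
    then show ?case by (simp add: A_def)
  next
    case (step k)
    have "(\<Sum>n=M..<Suc k. a n * f n) - A (Suc k) * f (Suc k)
        = ((\<Sum>n=M..<k. a n * f n) - A k * f k) + A (Suc k) * (f k - f (Suc k))"
      using step.hyps by (simp add: A_def algebra_simps)
    also have "\<bar>\<dots>\<bar> \<le> B * (f M - f k) + B * (f k - f (Suc k))"
      using step f(1)[of k] a[of "Suc k"]
      by (intro order.trans[OF abs_triangle_ineq] add_mono) (auto simp: abs_mult A_def intro!: mult_mono)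
    finally show ?case by (simp add: algebra_simps)
  qed
  moreover have "\<bar>A k * f k\<bar> \<le> B * f k"
    using a[of k] f(2)[OF True] by (simp add: abs_mult A_def mult_right_mono)
  ultimately show ?thesis by (simp add: algebra_simps)
next
  case False
  moreover have "0 \<le> B" using a[of M] by simp
  ultimately show ?thesis using f(2)[of M] by simp
qed

text \<open>The increment of ln at n is at most 1 / n, which is at most ln n / n once n is at least
  e; this is where 3 comes from.\<close>

lemma ln_over_n_decreasing:
  fixes n :: nat
  assumes "n \<ge> 3"
  shows "ln (real (Suc n)) / real (Suc n) \<le> ln (real n) / real n"
proof -
  have "1 \<le> ln (3::real)" using exp_le by (subst ln_ge_iff) auto
  also have "\<dots> \<le> ln (real n)" using assms by simp
  finally have 1: "1 \<le> ln (real n)" .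
  have "n * (ln (real (Suc n)) - ln (real n)) \<le> ln (real n)"
    using ln_Suc_diff_le[of n] 1 assms by (simp add: field_simps)
  then show ?thesis using assms by (simp add: field_simps)
qed

text \<open>Only the prime powers p^k with k \<ge> 2 contribute. For fixed p the geometric series
  gives at most 2 ln p / p^2, and ln p \<le> 2 sqrt p turns this into a term of a convergent
  series.\<close>

lemma sum_mangoldt_nonprime_bounded:
  "\<exists>C. \<forall>N. (\<Sum>d | d \<in> {1..N} \<and> \<not> prime d. mangoldt d / real d) \<le> C"
proof -
  define g :: "nat \<Rightarrow> real" where "g p = 4 * real p powr (- 3 / 2)" for p
  have "summable g" unfolding g_def by (intro summable_mult) (simp add: summable_real_powr_iff)
  have "(\<Sum>d | d \<in> {1..N} \<and> \<not> prime d. mangoldt d / real d) \<le> suminf g" for N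
  proof -
    let ?A = "{d \<in> {1..N}. primepow d \<and> \<not> prime d}"
    define h where "h = (\<lambda>(p::nat, k). p ^ k)"
    define Q where "Q = {p \<in> {1..N}. prime p} \<times> {2..N}"
    have "(\<Sum>d | d \<in> {1..N} \<and> \<not> prime d. mangoldt d / real d) = (\<Sum>d\<in>?A. mangoldt d / real d)"
      by (intro sum.mono_neutral_right) (auto simp: mangoldt_def)
    also have "\<dots> \<le> (\<Sum>d\<in>h ` Q. mangoldt d / real d)"
    proof (intro sum_mono2)
      show "?A \<subseteq> h ` Q"
      proof
        fix d assume d: "d \<in> ?A"
        then obtain p k where pk: "prime p" "k > 0" "d = p ^ k"
          by (auto simp: primepow_def)
        then have "k \<noteq> 1" using d by auto
        have "p \<le> d" using pk by (metis self_le_power prime_ge_1_nat)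
        moreover have "k \<le> d" using pk by (metis less_exp order.strict_trans2 power_mono prime_ge_2_nat less_imp_le zero_le)
        ultimately have "(p, k) \<in> Q"
          using pk d \<open>k \<noteq> 1\<close> prime_ge_1_nat[of p] unfolding Q_def by auto
        then show "d \<in> h ` Q" using pk unfolding h_def by force
      qed
    qed (auto simp: Q_def intro!: divide_nonneg_nonneg mangoldt_nonneg)
    also have "\<dots> \<le> (\<Sum>(p, k)\<in>Q. mangoldt (p ^ k) / real (p ^ k))"
      using sum_image_le[of Q "\<lambda>d. mangoldt d / real d" h]
      by (auto simp: Q_def h_def case_prod_unfold o_def mangoldt_nonneg)
    also have "\<dots> = (\<Sum>p\<in>{p \<in> {1..N}. prime p}. \<Sum>k=2..N. mangoldt (p ^ k) / real (p ^ k))"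
      unfolding Q_def by (rule sum.cartesian_product[symmetric])
    also have "\<dots> \<le> (\<Sum>p\<in>{p \<in> {1..N}. prime p}. g p)"
    proof (intro sum_mono)
      fix p assume "p \<in> {p \<in> {1..N}. prime p}"
      then have p: "prime p" by auto
      then have p2: "p \<ge> 2" by (rule prime_ge_2_nat)
      have "(\<Sum>k=2..N. mangoldt (p ^ k) / real (p ^ k)) = ln p * (\<Sum>k=2..N. (1 / real p) ^ k)"
        using p by (simp add: sum_distrib_left power_divide mangoldt_primepow)
      also have "\<dots> \<le> ln p * (2 / real p ^ 2)"
      proof (intro mult_left_mono)
        \<comment> \<open>Subtracting the last term strengthens the claim enough for induction,
          since 2 / p^(N+1) \<le> 1 / p^N.\<close>
        have "(\<Sum>k=2..N. (1 / real p) ^ k) \<le> 2 / real p ^ 2 - (1 / real p) ^ N * (if N \<ge> 2 then 1 else 0)"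
        proof (induction N)
          case (Suc N)
          show ?case
          proof (cases "N \<ge> 2")
            case True
            have "2 * (1 / real p) ^ Suc N \<le> (1 / real p) ^ N" using p2 by (simp add: field_simps)
            with True Suc show ?thesis by simp
          next
            case False
            then have "N = 0 \<or> N = 1" by auto
            then show ?thesis using p2 by (auto simp: power_divide numeral_2_eq_2)
          qed
        qed auto
        also have "\<dots> \<le> 2 / real p ^ 2" by simp
        finally show "(\<Sum>k=2..N. (1 / real p) ^ k) \<le> 2 / real p ^ 2" .
      qed (use p2 in auto)
      also have "\<dots> \<le> (real p powr (1 / 2) / (1 / 2)) * (2 / real p ^ 2)"
        using p2 by (intro mult_right_mono ln_powr_bound) auto
      also have "\<dots> = g p"
        using powr_diff[of "real p" "1 / 2" 2] p2 by (simp add: g_def)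
      finally show "(\<Sum>k=2..N. mangoldt (p ^ k) / real (p ^ k)) \<le> g p" .
    qed
    also have "\<dots> \<le> suminf g"
      by (intro sum_le_suminf \<open>summable g\<close>) (auto simp: g_def)
    finally show ?thesis .
  qed
  then show ?thesis by blast
qed

section \<open>Mertens estimates twisted by a character\<close>

text \<open>Abstracts a nonprincipal real Dirichlet character: cancellation over full periods enters
  only as a uniform bound on sums over intervals, the form that Abel summation takes.\<close>

locale bounded_character =
  fixes \<eta> :: "nat \<Rightarrow> real" and B :: real
  assumes mult: "\<eta> (m * n) = \<eta> m * \<eta> n"
    and abs_le_1: "\<bar>\<eta> n\<bar> \<le> 1"
    and sum_bound: "\<bar>\<Sum>n=a..<b. \<eta> n\<bar> \<le> B"
begin

lemma B_nonneg: "B \<ge> 0"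
  using sum_bound[of 0 0] by simp

text \<open>Partial sums of the Dirichlet series of the character at 1; the limit \<open>L\<close>
  is L(1, \<open>\<eta>\<close>).\<close>

definition partial_L :: "nat \<Rightarrow> real" where
  "partial_L N = (\<Sum>n=1..N. \<eta> n / real n)"

lemma partial_L_diff: "M \<le> N \<Longrightarrow> \<bar>partial_L N - partial_L M\<bar> \<le> B / real (Suc M)"
proof -
  assume "M \<le> N"
  then have "partial_L N - partial_L M = (\<Sum>n\<in>{1..N}-{1..M}. \<eta> n / real n)"
    unfolding partial_L_def by (subst sum_diff) auto
  also have "{1..N} - {1..M} = {Suc M..<Suc N}" by auto
  also have "(\<Sum>n=Suc M..<Suc N. \<eta> n / real n) = (\<Sum>n=Suc M..<Suc N. \<eta> n * (1 / real n))" by simp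
  finally have "\<bar>partial_L N - partial_L M\<bar> = \<bar>\<Sum>n=Suc M..<Suc N. \<eta> n * (1 / real n)\<bar>" by simp
  also have "\<dots> \<le> B * (1 / real (Suc M))"
    by (rule sum_Abel_bound[OF sum_bound]) (auto simp: field_simps)
  finally show ?thesis by simp
qed

lemma convergent_partial_L: "convergent partial_L"
proof -
  have "Cauchy partial_L"
  proof (rule metric_CauchyI)
    fix e :: real assume "e > 0"
    have "(\<lambda>M. B / real (Suc M)) \<longlonglongrightarrow> 0" by real_asymp
    then have "eventually (\<lambda>M. B / real (Suc M) < e / 2) sequentially"
      using \<open>e > 0\<close> by (intro order_tendstoD(2)) auto
    then obtain M where M: "B / real (Suc M) < e / 2"
      by (auto simp: eventually_sequentially)
    have "dist (partial_L m) (partial_L n) < e" if "m \<ge> M" "n \<ge> M" for m n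
      using partial_L_diff[of M m] partial_L_diff[of M n] that M
      unfolding dist_real_def by linarith
    then show "\<exists>M. \<forall>m\<ge>M. \<forall>n\<ge>M. dist (partial_L m) (partial_L n) < e" by blast
  qed
  then show ?thesis by (simp add: Cauchy_convergent_iff)
qed

definition L :: real where "L = lim partial_L"

lemma partial_L_bound: "\<bar>partial_L M - L\<bar> \<le> B / real (Suc M)"
proof -
  have "partial_L \<longlonglongrightarrow> L"
    using convergent_partial_L unfolding L_def by (rule convergent_LIMSEQ_iff[THEN iffD1])
  then have "(\<lambda>N. \<bar>partial_L N - partial_L M\<bar>) \<longlonglongrightarrow> \<bar>L - partial_L M\<bar>"
    by (intro tendsto_intros)
  then have "\<bar>L - partial_L M\<bar> \<le> B / real (Suc M)"
    by (rule tendsto_upperbound) (auto simp: eventually_sequentially intro!: exI[of _ M] partial_L_diff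
             simp del: of_nat_Suc)
  then show ?thesis by linarith
qed

text \<open>Abel summation from 3 on, where ln n / n decreases; the terms at 1 and 2 together
  contribute at most 1.\<close>

lemma sum_chi_ln_bounded: "\<exists>C. \<forall>N. \<bar>\<Sum>n=1..N. \<eta> n * ln (real n) / real n\<bar> \<le> C"
proof -
  define f where "f n = ln (real n) / real n" for n :: nat
  have "\<bar>\<Sum>n=1..N. \<eta> n * f n\<bar> \<le> 1 + B * f 3" for N
  proof -
    have 3: "\<bar>\<Sum>n=3..<Suc N. \<eta> n * f n\<bar> \<le> B * f 3"
      by (rule sum_Abel_bound[OF sum_bound]) (auto simp: f_def ln_over_n_decreasing simp del: of_nat_Suc)
    have f2: "\<bar>\<eta> 2 * f 2\<bar> \<le> 1"
      using abs_le_1[of 2] ln_2_less_1 unfolding f_def abs_mult by (intro mult_le_one) auto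
    have f3: "0 \<le> B * f 3" using B_nonneg by (simp add: f_def)
    consider "N = 0" | "N = 1" | "N \<ge> 2" by linarith
    then show ?thesis
    proof cases
      case 3
      then have "{1..N} = {1, 2} \<union> {3..<Suc N}" by auto
      then have "(\<Sum>n=1..N. \<eta> n * f n) = \<eta> 1 * f 1 + \<eta> 2 * f 2 + (\<Sum>n=3..<Suc N. \<eta> n * f n)"
        by (subst \<open>{1..N} = _\<close>, subst sum.union_disjoint) auto
      moreover have "f 1 = 0" by (simp add: f_def)
      ultimately show ?thesis using f2 \<open>\<bar>\<Sum>n=3..<Suc N. \<eta> n * f n\<bar> \<le> B * f 3\<close> by auto
    qed (use f3 in \<open>auto simp: f_def\<close>)
  qed
  then show ?thesis by (auto simp: f_def intro!: exI[of _ "1 + B * ln 3 / 3"])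
qed

text \<open>Expanding ln n over divisors writes the bounded sum of \<open>sum_chi_ln_bounded\<close>
  as a sum over d of \<open>\<eta>\<close> d \<open>mangoldt\<close> d / d times
  \<open>partial_L\<close> (N div d). Replacing each partial sum by \<open>L\<close> costs at most B
  d / N, in total at most 4 B by Chebyshev's bound. So \<open>L\<close> times the sum in question is
  bounded, and \<open>L\<close> is nonzero.\<close>

lemma sum_chi_mangoldt_bounded:
  assumes "L \<noteq> 0"
  shows "\<exists>C. \<forall>N. \<bar>\<Sum>d=1..N. \<eta> d * mangoldt d / real d\<bar> \<le> C"
proof -
  obtain C where C: "\<And>N. \<bar>\<Sum>n=1..N. \<eta> n * ln (real n) / real n\<bar> \<le> C"
    using sum_chi_ln_bounded by blast
  have "\<bar>\<Sum>d=1..N. \<eta> d * mangoldt d / real d\<bar> \<le> (C + 4 * B) / \<bar>L\<bar>" for N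
  proof -
    define W where "W = (\<Sum>d=1..N. \<eta> d * mangoldt d / real d)"
    have "(\<Sum>n=1..N. \<eta> n * ln (real n) / real n)
        = (\<Sum>n=1..N. \<Sum>d | d dvd n. (\<eta> d * mangoldt d / real d) * (\<eta> (n div d) / real (n div d)))"
    proof (intro sum.cong refl)
      fix n assume n: "n \<in> {1..N}"
      have "\<eta> n * ln (real n) / real n = (\<Sum>d | d dvd n. \<eta> n * mangoldt d / real n)"
        using n mangoldt_sum[of n, where ?'a = real]
        by (simp add: sum_distrib_left[symmetric] sum_divide_distrib[symmetric])
      also have "\<dots> = (\<Sum>d | d dvd n. (\<eta> d * mangoldt d / real d) * (\<eta> (n div d) / real (n div d)))"
      proof (intro sum.cong refl)
        fix d assume "d \<in> {d. d dvd n}"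
        then obtain e where e: "n = d * e" by blast
        with n have "d > 0" by (cases "d = 0") auto
        then show "\<eta> n * mangoldt d / real n = (\<eta> d * mangoldt d / real d) * (\<eta> (n div d) / real (n div d))"
          unfolding e mult by simp
      qed
      finally show "\<eta> n * ln (real n) / real n
        = (\<Sum>d | d dvd n. (\<eta> d * mangoldt d / real d) * (\<eta> (n div d) / real (n div d)))" .
    qed
    also have "\<dots> = (\<Sum>d=1..N. (\<eta> d * mangoldt d / real d) * partial_L (N div d))"
      by (subst sum_divisors_swap[where g = "\<lambda>d m. (\<eta> d * mangoldt d / real d) * (\<eta> m / real m)"])
         (simp add: partial_L_def sum_distrib_left)
    finally have eq: "(\<Sum>n=1..N. \<eta> n * ln (real n) / real n) = \<dots>" .
    have "(\<Sum>n=1..N. \<eta> n * ln (real n) / real n) - L * W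
        = (\<Sum>d=1..N. (\<eta> d * mangoldt d / real d) * (partial_L (N div d) - L))"
      unfolding eq W_def sum_distrib_left sum_subtractf[symmetric]
      by (intro sum.cong refl) (simp add: algebra_simps diff_divide_distrib)
    also have "\<bar>\<dots>\<bar> \<le> (\<Sum>d=1..N. mangoldt d * B / real N)"
    proof (rule order.trans[OF sum_abs], intro sum_mono)
      fix d assume d: "d \<in> {1..N}"
      have "real N / real d \<le> real (Suc (N div d))"
        using real_nat_div_gt[of N d] by simp
      then have "B / real (Suc (N div d)) \<le> B / (real N / real d)"
        using d B_nonneg by (intro divide_left_mono) auto
      with partial_L_bound[of "N div d"] have "\<bar>partial_L (N div d) - L\<bar> \<le> B * real d / real N" by simp
      moreover have "\<bar>\<eta> d * mangoldt d / real d\<bar> \<le> mangoldt d / real d"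
        using abs_le_1[of d] mangoldt_nonneg[of d]
        by (auto simp: abs_mult intro!: divide_right_mono mult_left_le_one_le)
      ultimately have "\<bar>\<eta> d * mangoldt d / real d\<bar> * \<bar>partial_L (N div d) - L\<bar>
          \<le> (mangoldt d / real d) * (B * real d / real N)"
        using mangoldt_nonneg[of d] by (intro mult_mono) auto
      also have "\<dots> = mangoldt d * B / real N" using d by simp
      finally show "\<bar>\<eta> d * mangoldt d / real d * (partial_L (N div d) - L)\<bar> \<le> mangoldt d * B / real N"
        by (simp add: abs_mult)
    qed
    also have "\<dots> = (\<Sum>d=1..N. mangoldt d) * (B / real N)"
      by (simp add: sum_distrib_right sum_divide_distrib)
    also have "\<dots> \<le> (4 * real N) * (B / real N)"
      using B_nonneg by (intro mult_right_mono sum_mangoldt_le) auto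
    also have "\<dots> \<le> 4 * B" using B_nonneg by simp
    finally have "\<bar>L * W\<bar> \<le> C + 4 * B" using C[of N] by linarith
    then show ?thesis using assms unfolding W_def[symmetric] by (simp add: abs_mult field_simps)
  qed
  then show ?thesis by blast
qed

end

lemma sum_prime_restrict_bounded:
  fixes g :: "nat \<Rightarrow> real"
  assumes "\<And>n. \<bar>g n\<bar> \<le> 1"
  shows "\<exists>C. \<forall>N. \<bar>(\<Sum>d=1..N. g d * mangoldt d / real d) - (\<Sum>p | p \<in> {1..N} \<and> prime p. g p * ln (real p) / real p)\<bar> \<le> C"
proof -
  obtain C where C: "\<And>N. (\<Sum>d | d \<in> {1..N} \<and> \<not> prime d. mangoldt d / real d) \<le> C"
    using sum_mangoldt_nonprime_bounded by blast
  have "\<bar>(\<Sum>d=1..N. g d * mangoldt d / real d) - (\<Sum>p | p \<in> {1..N} \<and> prime p. g p * ln (real p) / real p)\<bar> \<le> C" for N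
  proof -
    have "(\<Sum>d=1..N. g d * mangoldt d / real d)
        = (\<Sum>d | d \<in> {1..N} \<and> prime d. g d * mangoldt d / real d)
          + (\<Sum>d | d \<in> {1..N} \<and> \<not> prime d. g d * mangoldt d / real d)"
      by (subst sum.union_disjoint[symmetric]) (auto intro!: sum.cong)
    moreover have "(\<Sum>d | d \<in> {1..N} \<and> prime d. g d * mangoldt d / real d)
        = (\<Sum>p | p \<in> {1..N} \<and> prime p. g p * ln (real p) / real p)"
      by (intro sum.cong) auto
    moreover have "\<bar>\<Sum>d | d \<in> {1..N} \<and> \<not> prime d. g d * mangoldt d / real d\<bar>
        \<le> (\<Sum>d | d \<in> {1..N} \<and> \<not> prime d. mangoldt d / real d)"
      using assms mangoldt_nonneg
      by (intro order.trans[OF sum_abs] sum_mono)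
         (auto simp: abs_mult intro!: divide_right_mono mult_left_le_one_le)
    ultimately show ?thesis using C[of N] by linarith
  qed
  then show ?thesis by blast
qed

context bounded_character
begin

text \<open>Outside F the indicator of T is (1 + s \<open>\<eta>\<close>) / 2, so the sum is half of
  Mertens' sum plus a bounded twisted sum. F absorbs primes where the character vanishes or T
  deviates from it; the sign s lets one statement serve both classes of primes.\<close>

lemma mertens_half:
  assumes "L \<noteq> 0" "finite F" "\<And>p. prime p \<Longrightarrow> p \<notin> F \<Longrightarrow> \<eta> p = 1 \<or> \<eta> p = -1"
    and T: "\<And>p. prime p \<Longrightarrow> p \<notin> F \<Longrightarrow> p \<in> T \<longleftrightarrow> \<eta> p = s" and s: "s = 1 \<or> s = -1"
  shows "\<exists>C. \<forall>N\<ge>1. \<bar>(\<Sum>p | p \<in> {1..N} \<and> prime p \<and> p \<in> T. ln (real p) / real p) - ln (real N) / 2\<bar> \<le> C"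
proof -
  obtain C1 where C1: "\<And>N. \<bar>\<Sum>d=1..N. \<eta> d * mangoldt d / real d\<bar> \<le> C1"
    using sum_chi_mangoldt_bounded[OF assms(1)] by blast
  obtain C2 where C2: "\<And>N. \<bar>(\<Sum>d=1..N. \<eta> d * mangoldt d / real d) - (\<Sum>p | p \<in> {1..N} \<and> prime p. \<eta> p * ln (real p) / real p)\<bar> \<le> C2"
    using sum_prime_restrict_bounded[of \<eta>] abs_le_1 by blast
  obtain C3 where C3: "\<And>N. \<bar>(\<Sum>d=1..N. mangoldt d / real d) - (\<Sum>p | p \<in> {1..N} \<and> prime p. ln (real p) / real p)\<bar> \<le> C3"
    using sum_prime_restrict_bounded[of "\<lambda>_. 1"] by auto
  define C4 where "C4 = (\<Sum>p\<in>F. ln (real p) / real p)"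
  have "\<bar>(\<Sum>p | p \<in> {1..N} \<and> prime p \<and> p \<in> T. ln (real p) / real p) - ln (real N) / 2\<bar> \<le> (4 + C3 + C1 + C2) / 2 + C4"
    if N: "N \<ge> 1" for N
  proof -
    let ?P = "{p. p \<in> {1..N} \<and> prime p}"
    have nonneg: "0 \<le> ln (real p) / real p" for p by (cases "p = 0") auto
    have "(\<Sum>p | p \<in> {1..N} \<and> prime p \<and> p \<in> T. ln (real p) / real p)
        = (\<Sum>p\<in>?P. if p \<in> T then ln (real p) / real p else 0)"
      by (subst sum.inter_restrict[symmetric]) (auto intro!: sum.cong)
    moreover have "\<bar>(\<Sum>p\<in>?P. if p \<in> T then ln (real p) / real p else 0) - (\<Sum>p\<in>?P. (1 + s * \<eta> p) / 2 * (ln (real p) / real p))\<bar> \<le> C4"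
    proof -
      have "(\<Sum>p\<in>?P. if p \<in> T then ln (real p) / real p else 0) - (\<Sum>p\<in>?P. (1 + s * \<eta> p) / 2 * (ln (real p) / real p))
         = (\<Sum>p\<in>?P. (of_bool (p \<in> T) - (1 + s * \<eta> p) / 2) * (ln (real p) / real p))"
        unfolding sum_subtractf[symmetric] by (intro sum.cong) (auto simp: algebra_simps)
      also have "\<bar>\<dots>\<bar> \<le> (\<Sum>p\<in>?P. if p \<in> F then ln (real p) / real p else 0)"
      proof (intro order.trans[OF sum_abs] sum_mono)
        fix p assume p: "p \<in> ?P"
        show "\<bar>(of_bool (p \<in> T) - (1 + s * \<eta> p) / 2) * (ln (real p) / real p)\<bar> \<le> (if p \<in> F then ln (real p) / real p else 0)"
        proof (cases "p \<in> F")
          case True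
          have l: "0 \<le> ln (real p) / real p" using p by auto
          have "\<bar>of_bool (p \<in> T) - (1 + s * \<eta> p) / 2\<bar> \<le> 1"
            using abs_le_1[of p] s by (auto simp: of_bool_def abs_le_iff)
          then have "\<bar>of_bool (p \<in> T) - (1 + s * \<eta> p) / 2\<bar> * \<bar>ln (real p) / real p\<bar> \<le> ln (real p) / real p"
            using mult_left_le_one_le[OF l] by (simp only: abs_of_nonneg[OF l] abs_ge_zero)
          then show ?thesis using True by (simp add: abs_mult)
        next
          case False
          with assms(3)[of p] T[of p] p s have "of_bool (p \<in> T) - (1 + s * \<eta> p) / 2 = 0"
            by auto
          then show ?thesis using False by (simp only: mult_zero_left abs_zero if_False order.refl)
        qed
      qed
      also have "\<dots> = (\<Sum>p\<in>?P \<inter> F. ln (real p) / real p)"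
        by (subst sum.inter_restrict) auto
      also have "\<dots> \<le> C4"
        unfolding C4_def using assms(2)
        by (intro sum_mono2) (auto simp: nonneg)
      finally show ?thesis .
    qed
    moreover have "(\<Sum>p\<in>?P. (1 + s * \<eta> p) / 2 * (ln (real p) / real p))
        = ((\<Sum>p\<in>?P. ln (real p) / real p) + s * (\<Sum>p\<in>?P. \<eta> p * ln (real p) / real p)) / 2"
      by (simp add: sum_distrib_left sum.distrib[symmetric] sum_divide_distrib algebra_simps add_divide_distrib)
    moreover have "\<bar>s * (\<Sum>p\<in>?P. \<eta> p * ln (real p) / real p)\<bar> \<le> C1 + C2"
      using C1[of N] C2[of N] s by auto
    moreover have "\<bar>(\<Sum>p\<in>?P. ln (real p) / real p) - ln (real N)\<bar> \<le> 4 + C3"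
      using C3[of N] sum_mangoldt_over_n[of N] N by linarith
    ultimately show ?thesis by (simp add: abs_le_iff field_simps)
  qed
  then show ?thesis by blast
qed

end

section \<open>Squarefree products of half of the primes\<close>

lemma squarefree_eq_prod_prime_factors:
  fixes n :: nat
  assumes "squarefree n"
  shows "n = \<Prod>(prime_factors n)"
proof -
  have n: "n \<noteq> 0" using assms by (metis not_squarefree_0)
  have "n = (\<Prod>p\<in>prime_factors n. p ^ multiplicity p n)"
    using prod_prime_factors[OF n] by simp
  also have "\<dots> = \<Prod>(prime_factors n)"
    using assms squarefree_factorial_semiring'[OF n] by (intro prod.cong) auto
  finally show ?thesis .
qed

lemma prime_factors_prod_primes:
  fixes A :: "nat set"
  assumes "finite A" "\<And>p. p \<in> A \<Longrightarrow> prime p"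
  shows "prime_factors (\<Prod>A) = A"
proof -
  have "0 \<notin> A" using assms(2) by fastforce
  then have "prime_factors (\<Prod>A) = (\<Union>p\<in>A. prime_factors p)"
    using assms by (simp add: prime_factors_prod)
  also have "\<dots> = A"
    using assms by (auto simp: prime_factorization_prime)
  finally show ?thesis .
qed

definition squarefree_over :: "nat set \<Rightarrow> nat \<Rightarrow> nat set" where
  "squarefree_over S N = {n \<in> {1..N}. squarefree n \<and> prime_factors n \<subseteq> S}"

lemma finite_squarefree_over [simp, intro]: "finite (squarefree_over S N)"
  unfolding squarefree_over_def by auto

text \<open>A squarefree number is the product of its set of prime factors, so the sum is part of
  the expanded product of the factors 1 + 1 / p.\<close>

lemma sum_inverse_squarefree_over_le:
  assumes "\<And>p. p \<in> S \<Longrightarrow> prime p"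
  shows "(\<Sum>n\<in>squarefree_over S N. 1 / real n) \<le> exp (\<Sum>p\<in>S \<inter> {1..N}. 1 / real p)"
proof -
  let ?Q = "S \<inter> {1..N}"
  have fin: "finite ?Q" by auto
  have "(\<Sum>n\<in>squarefree_over S N. 1 / real n) = (\<Sum>n\<in>squarefree_over S N. \<Prod>p\<in>prime_factors n. 1 / real p)"
  proof (intro sum.cong refl)
    fix n assume "n \<in> squarefree_over S N"
    then have "real n = real (\<Prod>(prime_factors n))"
      using squarefree_eq_prod_prime_factors[of n] unfolding squarefree_over_def by auto
    then show "1 / real n = (\<Prod>p\<in>prime_factors n. 1 / real p)"
      by (simp add: prod_dividef)
  qed
  also have "\<dots> = (\<Sum>A\<in>prime_factors ` squarefree_over S N. \<Prod>p\<in>A. 1 / real p)"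
    by (subst sum.reindex)
       (auto intro!: inj_onI simp: squarefree_over_def, metis squarefree_eq_prod_prime_factors)
  also have "\<dots> \<le> (\<Sum>A\<in>Pow ?Q. \<Prod>p\<in>A. 1 / real p)"
  proof (intro sum_mono2)
    show "prime_factors ` squarefree_over S N \<subseteq> Pow ?Q"
    proof safe
      fix n p assume n: "n \<in> squarefree_over S N" and p: "p \<in> prime_factors n"
      then have "p dvd n" "prime p" "n > 0" "n \<le> N" by (auto simp: squarefree_over_def)
      then have "p \<in> {1..N}" using dvd_imp_le[of p n] prime_gt_0_nat[of p] by auto
      then show "p \<in> {1..N}" "p \<in> S" using n p by (auto simp: squarefree_over_def)
    qed
  qed (auto intro!: prod_nonneg)
  also have "\<dots> = (\<Prod>p\<in>?Q. 1 / real p + 1)"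
    using prod_add[OF fin, of "\<lambda>p. 1 / real p" "\<lambda>_. 1"] by simp
  also have "\<dots> = (\<Prod>p\<in>?Q. 1 + 1 / real p)" by (simp add: add.commute)
  also have "\<dots> \<le> exp (\<Sum>p\<in>?Q. 1 / real p)"
    by (intro prod_le_exp_sum) auto
  finally show ?thesis .
qed

lemma sum_inverse_squares_le: "(\<Sum>q=1..N. 1 / real q ^ 2) \<le> 2"
proof -
  have "N \<ge> 1 \<Longrightarrow> (\<Sum>q=1..N. 1 / real q ^ 2) \<le> 2 - 1 / real N"
  proof (induction N rule: dec_induct)
    case (step N)
    have "1 / real (Suc N) ^ 2 \<le> 1 / real N - 1 / real (Suc N)"
    proof -
      have "1 / real (Suc N) ^ 2 \<le> 1 / (real N * real (Suc N))"
        using step.hyps by (intro divide_left_mono) (auto simp: power2_eq_square)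
      also have "\<dots> = 1 / real N - 1 / real (Suc N)" using step.hyps by (simp add: field_simps)
      finally show ?thesis .
    qed
    with step show ?case by simp
  qed auto
  moreover have "2 - 1 / real N \<le> 2" by simp
  ultimately have "N \<ge> 1 \<Longrightarrow> ?thesis" by linarith
  then show ?thesis by (cases "N \<ge> 1") auto
qed

text \<open>Every \<open>n\<close> factors as \<open>a b q\<^sup>2\<close> with \<open>a\<close> and \<open>b\<close> squarefree over \<open>S\<close> and \<open>T\<close>.\<close>
lemma ln_le_sum_inverse_squarefree_over:
  assumes "\<And>p. prime p \<Longrightarrow> p \<in> S \<or> p \<in> T"
  shows "ln (real N) \<le> (\<Sum>a\<in>squarefree_over S N. 1 / real a) * (\<Sum>b\<in>squarefree_over T N. 1 / real b) * 2"
proof (cases "N = 0")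
  case False
  let ?A = "squarefree_over S N" and ?B = "squarefree_over T N"
  define h where "h = (\<lambda>(a::nat, b::nat, q::nat). a * b * q ^ 2)"
  have "ln (real N) \<le> ln (real N + 1)" using False by simp
  also have "\<dots> \<le> harm N" by (rule ln_le_harm)
  also have "\<dots> = (\<Sum>n=1..N. 1 / real n)" by (simp add: harm_def inverse_eq_divide)
  also have "\<dots> \<le> (\<Sum>n\<in>h ` (?A \<times> ?B \<times> {1..N}). 1 / real n)"
  proof (intro sum_mono2)
    show "{1..N} \<subseteq> h ` (?A \<times> ?B \<times> {1..N})"
    proof
      fix n assume n: "n \<in> {1..N}"
      define s where "s = squarefree_part n"
      define q where "q = square_part n"
      \<comment> \<open>The primes of the squarefree part are divided between the two sets; one that
        lies in both goes to \<open>A\<close>.\<close>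
      define A where "A = prime_factors s \<inter> S"
      define B where "B = prime_factors s - S"
      have s: "squarefree s" unfolding s_def by auto
      have nsq: "n = s * q ^ 2" unfolding s_def q_def by (rule squarefree_decompose)
      have AB: "\<Prod>A * \<Prod>B = s"
      proof -
        have "\<Prod>A * \<Prod>B = \<Prod>(A \<union> B)"
          unfolding A_def B_def by (intro prod.union_disjoint[symmetric]) auto
        also have "A \<union> B = prime_factors s" unfolding A_def B_def by auto
        finally show ?thesis using squarefree_eq_prod_prime_factors[OF s] by simp
      qed
      have primes: "prime p" if "p \<in> A \<union> B" for p
        using that unfolding A_def B_def by auto
      have pA: "prime_factors (\<Prod>A) = A" and pB: "prime_factors (\<Prod>B) = B"
        using primes by (auto intro!: prime_factors_prod_primes simp: A_def B_def)
      have dvd: "\<Prod>A dvd s" "\<Prod>B dvd s" "s dvd n" "q dvd n"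
        using AB nsq by (metis dvd_triv_left dvd_triv_right, metis dvd_triv_left dvd_triv_right,
          metis dvd_triv_left, metis dvd_mult power2_eq_square dvd_triv_left)
      have le: "d dvd n \<Longrightarrow> d \<in> {1..N}" for d
        using n dvd_imp_le[of d n] by (cases "d = 0") auto
      have "\<Prod>A \<in> ?A" "\<Prod>B \<in> ?B"
        using dvd le[of "\<Prod>A"] le[of "\<Prod>B"] squarefree_mono[OF _ s] assms pA pB primes
        unfolding squarefree_over_def A_def B_def
        by (auto intro: dvd_trans)
      moreover have "q \<in> {1..N}" using le dvd by blast
      moreover have "n = h (\<Prod>A, \<Prod>B, q)" unfolding h_def nsq AB[symmetric] by simp
      ultimately show "n \<in> h ` (?A \<times> ?B \<times> {1..N})" by blast
    qed
  qed auto
  also have "\<dots> \<le> (\<Sum>x\<in>?A \<times> ?B \<times> {1..N}. 1 / real (h x))"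
    using sum_image_le[of "?A \<times> ?B \<times> {1..N}" "\<lambda>n. 1 / real n" h] by (auto simp: o_def)
  also have "\<dots> = (\<Sum>a\<in>?A. \<Sum>b\<in>?B. \<Sum>q=1..N. 1 / real a * (1 / real b) * (1 / real q ^ 2))"
    unfolding h_def sum.cartesian_product by (intro sum.cong) auto
  also have "\<dots> = (\<Sum>a\<in>?A. 1 / real a) * (\<Sum>b\<in>?B. 1 / real b) * (\<Sum>q=1..N. 1 / real q ^ 2)"
    by (simp only: sum_distrib_left[symmetric] sum_distrib_right[symmetric])
  also have "\<dots> \<le> (\<Sum>a\<in>?A. 1 / real a) * (\<Sum>b\<in>?B. 1 / real b) * 2"
    by (intro mult_left_mono sum_inverse_squares_le mult_nonneg_nonneg sum_nonneg) auto
  finally show ?thesis .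
qed (auto intro!: mult_nonneg_nonneg sum_nonneg)

section \<open>Lower bound for the number of squarefree products\<close>

locale half_primes =
  fixes S T :: "nat set" and C :: real
  assumes S_prime: "p \<in> S \<Longrightarrow> prime p" and T_prime: "p \<in> T \<Longrightarrow> prime p"
    and cover: "prime p \<Longrightarrow> p \<in> S \<or> p \<in> T"
    and S_sum: "N \<ge> 1 \<Longrightarrow> \<bar>(\<Sum>p\<in>S \<inter> {1..N}. ln (real p) / real p) - ln (real N) / 2\<bar> \<le> C"
    and T_sum: "N \<ge> 1 \<Longrightarrow> (\<Sum>p\<in>T \<inter> {1..N}. ln (real p) / real p) \<le> ln (real N) / 2 + C"
begin

lemma C_nonneg: "C \<ge> 0"
  using S_sum[of 1] by simp

text \<open>Partial summation in inductive form. \<open>X\<close> N is the nonnegative slack in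
  \<open>T_sum\<close>; in \<open>R\<close> N + \<open>X\<close> N / ln N the contribution of a new
  prime cancels, and each step adds at most half the increment of ln ln N. The constant is fitted to
  N = 2.\<close>

lemma sum_inverse_T:
  defines "K \<equiv> 2 + C / ln 2 - ln (ln 2) / 2"
  assumes "N \<ge> 2"
  shows "(\<Sum>p\<in>T \<inter> {1..N}. 1 / real p) \<le> ln (ln (real N)) / 2 + K"
proof -
  define s where "s N = (\<Sum>p\<in>T \<inter> {1..N}. ln (real p) / real p)" for N
  define R where "R N = (\<Sum>p\<in>T \<inter> {1..N}. 1 / real p)" for N
  define X where "X N = ln (real N) / 2 + C - s N" for N
  have X: "X N \<ge> 0" if "N \<ge> 1" for N
    using T_sum[OF that] unfolding X_def s_def by simp
  have step_set: "T \<inter> {1..Suc N} = (if Suc N \<in> T then insert (Suc N) (T \<inter> {1..N}) else T \<inter> {1..N})" for N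
    by (auto simp: le_Suc_eq)
  have "R N + X N / ln (real N) \<le> ln (ln (real N)) / 2 + K"
    using assms(2)
  proof (induction N rule: dec_induct)
    case base
    have "R 2 \<le> (\<Sum>p\<in>{1..2}. 1 / real p)" unfolding R_def by (intro sum_mono2) auto
    also have "{1..2::nat} = {1, 2}" by auto
    finally have "R 2 \<le> 3 / 2" by simp
    moreover have "s 2 \<ge> 0" unfolding s_def by (intro sum_nonneg) auto
    then have "X 2 / ln 2 \<le> (ln 2 / 2 + C) / ln 2" unfolding X_def by (intro divide_right_mono) auto
    then have "X 2 / ln 2 \<le> 1 / 2 + C / ln 2" by (simp add: add_divide_distrib)
    ultimately show ?case unfolding K_def by simp
  next
    case (step N)
    define l l' where "l = ln (real N)" and "l' = ln (real (Suc N))"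
    have l: "0 < l" "l \<le> l'" using step.hyps unfolding l_def l'_def by auto
    have "R (Suc N) = R N + (s (Suc N) - s N) / l'"
      using step.hyps unfolding R_def s_def step_set l'_def by (auto simp: field_simps)
    moreover have "X (Suc N) = X N + (l' - l) / 2 - (s (Suc N) - s N)"
      unfolding X_def l_def l'_def by (simp add: field_simps)
    ultimately have "R (Suc N) + X (Suc N) / l' = R N + X N / l' + (1 - l / l') / 2"
      using l by (simp add: add_divide_distrib diff_divide_distrib)
    moreover have "X N / l' \<le> X N / l" using X[of N] step.hyps l by (intro divide_left_mono) auto
    moreover have "1 - l / l' \<le> ln l' - ln l"
      using ln_le_minus_one[of "l / l'"] l by (simp add: ln_div)
    ultimately show ?case using step.IH unfolding l_def l'_def by argo
  qed
  moreover have "X N / ln (real N) \<ge> 0" using X[of N] assms by simp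
  ultimately show ?thesis unfolding R_def by simp
qed

text \<open>The sums over S and T have product at least ln N / 2, while the one over T is at most a
  constant times sqrt (ln N). Hence the one over S is at least of that order.\<close>

lemma sum_inverse_squarefree_over_ge:
  obtains c where "c > 0" "\<And>N. N \<ge> 2 \<Longrightarrow> c * sqrt (ln (real N)) \<le> (\<Sum>a\<in>squarefree_over S N. 1 / real a)"
proof -
  define K where "K = 2 + C / ln 2 - ln (ln 2) / 2"
  have "1 / (2 * exp K) * sqrt (ln (real N)) \<le> (\<Sum>a\<in>squarefree_over S N. 1 / real a)" if N: "N \<ge> 2" for N
  proof -
    let ?A = "\<Sum>a\<in>squarefree_over S N. 1 / real a"
    have l: "ln (real N) > 0" using N by simp
    have A: "?A \<ge> 0" by (intro sum_nonneg) auto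
    have "(\<Sum>b\<in>squarefree_over T N. 1 / real b) \<le> exp (\<Sum>p\<in>T \<inter> {1..N}. 1 / real p)"
      by (rule sum_inverse_squarefree_over_le[OF T_prime])
    also have "\<dots> \<le> exp (ln (ln (real N)) / 2 + K)"
      using sum_inverse_T[OF N] unfolding K_def by simp
    also have "\<dots> = exp K * sqrt (ln (real N))"
      using l by (simp add: exp_add ln_sqrt[symmetric])
    finally have B: "(\<Sum>b\<in>squarefree_over T N. 1 / real b) \<le> exp K * sqrt (ln (real N))" .
    have "sqrt (ln (real N)) * sqrt (ln (real N)) = ln (real N)" using l by simp
    also have "\<dots> \<le> ?A * (\<Sum>b\<in>squarefree_over T N. 1 / real b) * 2"
      by (rule ln_le_sum_inverse_squarefree_over[OF cover])
    also have "\<dots> \<le> ?A * (exp K * sqrt (ln (real N))) * 2"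
      using A B by (intro mult_right_mono mult_left_mono) auto
    finally have "sqrt (ln (real N)) * sqrt (ln (real N)) \<le> (2 * exp K * ?A) * sqrt (ln (real N))"
      by (simp add: mult_ac)
    then have "sqrt (ln (real N)) \<le> 2 * exp K * ?A"
      using l by (subst (asm) mult_le_cancel_right) auto
    then show ?thesis by (simp add: field_simps)
  qed
  then show ?thesis using that[of "1 / (2 * exp K)"] by simp
qed

lemma card_S_interval_ge:
  obtains D :: nat where "D \<ge> 2"
    "\<And>Y. Y \<ge> D \<Longrightarrow> real Y / (real D * ln (real Y)) \<le> real (card (S \<inter> {Y div D<..Y}))"
proof -
  \<comment> \<open>With ln D \<ge> 4 C + 2 the main term ln D / 2 exceeds the two errors C by at
    least 1, so the primes in (Y / D, Y] carry weight at least 1. Each of them weighs at most D ln Y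
    / Y.\<close>
  define D where "D = nat \<lceil>exp (4 * C + 2)\<rceil>"
  have D: "real D \<ge> exp (4 * C + 2)" unfolding D_def by (simp add: real_nat_ceiling_ge)
  have "exp (4 * C + 2) \<ge> 1 + (4 * C + 2)" by (rule exp_ge_add_one_self)
  with D C_nonneg have "real D \<ge> 2" by linarith
  then have D2: "D \<ge> 2" by simp
  have lnD: "ln (real D) \<ge> 4 * C + 2"
    using D D2 by (subst ln_ge_iff) auto
  have "real Y / (real D * ln (real Y)) \<le> real (card (S \<inter> {Y div D<..Y}))" if Y: "Y \<ge> D" for Y
  proof -
    let ?Z = "Y div D"
    have Z: "?Z \<ge> 1" using Y D2 by (simp add: Suc_le_eq div_greater_zero_iff)
    have lY: "ln (real Y) > 0" using Y D2 by auto
    have "real ?Z \<le> real Y / real D" by (rule real_nat_div_le)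
    then have "ln (real ?Z) \<le> ln (real Y / real D)" using Z by (subst ln_le_cancel_iff) auto
    also have "\<dots> = ln (real Y) - ln (real D)" using Y D2 by (simp add: ln_div)
    finally have "1 \<le> (\<Sum>p\<in>S \<inter> {1..Y}. ln (real p) / real p) - (\<Sum>p\<in>S \<inter> {1..?Z}. ln (real p) / real p)"
      using S_sum[of Y] S_sum[of ?Z] Z lnD Y D2 by (simp add: abs_le_iff)
    also have "\<dots> = (\<Sum>p\<in>(S \<inter> {1..Y}) - (S \<inter> {1..?Z}). ln (real p) / real p)"
      by (subst sum_diff) (auto intro: order.trans[OF _ div_le_dividend])
    also have "(S \<inter> {1..Y}) - (S \<inter> {1..?Z}) = S \<inter> {?Z<..Y}" by auto
    also have "(\<Sum>p\<in>S \<inter> {?Z<..Y}. ln (real p) / real p) \<le> (\<Sum>p\<in>S \<inter> {?Z<..Y}. ln (real Y) / (real Y / real D))"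
    proof (intro sum_mono frac_le)
      fix p assume p: "p \<in> S \<inter> {?Z<..Y}"
      then have "real p \<ge> real ?Z + 1" by auto
      then show "real Y / real D \<le> real p" using real_nat_div_gt[of Y D] by linarith
      show "ln (real p) \<le> ln (real Y)" using p by auto
    qed (use Y D2 lY in auto)
    also have "\<dots> = real (card (S \<inter> {?Z<..Y})) * (ln (real Y) / (real Y / real D))" by simp
    finally show ?thesis using lY Y D2 by (simp add: field_simps)
  qed
  then show ?thesis using that D2 by blast
qed

lemma card_squarefree_over_ge:
  obtains c N0 where "c > 0"
    "\<And>N. N \<ge> N0 \<Longrightarrow> c * real N / sqrt (ln (real N)) \<le> real (card (squarefree_over S N))"
proof -
  obtain c where c: "c > 0"
    "\<And>N. N \<ge> 2 \<Longrightarrow> c * sqrt (ln (real N)) \<le> (\<Sum>a\<in>squarefree_over S N. 1 / real a)"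
    using sum_inverse_squarefree_over_ge by blast
  obtain D where D: "D \<ge> 2"
    "\<And>Y. Y \<ge> D \<Longrightarrow> real Y / (real D * ln (real Y)) \<le> real (card (S \<inter> {Y div D<..Y}))"
    using card_S_interval_ge by blast
  \<comment> \<open>This size gives 4 \<le> N div D, hence M \<ge> 2 below, and (4 D)^2 \<le> N,
    hence N \<le> M^4.\<close>
  define N0 where "N0 = (8 * D) ^ 2"
  have "c / (4 * real D) * real N / sqrt (ln (real N)) \<le> real (card (squarefree_over S N))" if N: "N \<ge> N0" for N
  proof -
    \<comment> \<open>For m \<le> M the primes p in (N / (m D), N / m] exceed m, so p is
      recognizable as the largest prime factor of m p.\<close>
    define M where "M = floor_sqrt (N div D)"
    have "8 * D * (8 * D) \<le> N" using N unfolding N0_def power2_eq_square .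
    have "D * 4 \<le> 8 * D * (8 * D)" using D(1) by simp
    also have "\<dots> \<le> N" by fact
    finally have "4 \<le> N div D" using D(1) by (simp add: less_eq_div_iff_mult_less_eq mult.commute)
    then have M2: "M \<ge> 2" unfolding M_def by (intro le_floor_sqrtI) auto
    have "M ^ 2 \<le> N div D" unfolding M_def by simp
    then have MD: "M ^ 2 * D \<le> N" using D(1) by (simp add: less_eq_div_iff_mult_less_eq)
    have N4: "N \<ge> 4" using \<open>4 \<le> N div D\<close> div_le_dividend[of N D] by linarith
    then have lN: "ln (real N) > 0" by simp
    \<comment> \<open>From N \<le> 4 D M^2 follows N^2 \<le> (4 D)^2 M^4, and one factor N on the
      left pays for (4 D)^2.\<close>
    have lnM: "ln (real N) / 4 \<le> ln (real M)"
    proof -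
      have "N div D < (Suc M) ^ 2" unfolding M_def by (rule Suc_floor_sqrt_power2_gt)
      also have "\<dots> \<le> (2 * M) ^ 2" using M2 by (intro power_mono) auto
      finally have "real (N div D) + 1 \<le> 4 * real M ^ 2"
        by (simp add: power_mult_distrib) (metis (mono_tags) Suc_leI of_nat_Suc of_nat_le_iff of_nat_mult of_nat_numeral of_nat_power add.commute)
      then have "real N / real D \<le> 4 * real M ^ 2" using real_nat_div_gt[of N D] by linarith
      then have NM: "real N \<le> 4 * real D * real M ^ 2" using D(1) by (simp add: field_simps)
      have "(8 * real D) ^ 2 \<le> real N"
        using N unfolding N0_def by (metis of_nat_le_iff of_nat_mult of_nat_numeral of_nat_power)
      then have "(4 * real D) ^ 2 \<le> real N" by (simp add: power_mult_distrib)
      then have "(4 * real D) ^ 2 * real N \<le> real N * real N" by (intro mult_right_mono) auto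
      also have "\<dots> = real N ^ 2" by (simp add: power2_eq_square)
      also have "real N ^ 2 \<le> (4 * real D * real M ^ 2) ^ 2" by (intro power_mono NM) auto
      also have "\<dots> = (4 * real D) ^ 2 * real M ^ 4" by (simp add: power_mult_distrib)
      finally have "real N \<le> real M ^ 4" using D(1) by simp
      then have "ln (real N) \<le> ln (real M ^ 4)" using N4 M2 by (subst ln_le_cancel_iff) auto
      also have "\<dots> = 4 * ln (real M)" using M2 by (simp add: ln_realpow)
      finally show ?thesis by simp
    qed
    define P where "P m = S \<inter> {N div m div D<..N div m}" for m
    define I where "I = (SIGMA m:squarefree_over S M. P m)"
    have big: "m < p" "N div m \<ge> D" "m * p \<le> N" if "m \<in> squarefree_over S M" "p \<in> P m" for m p
    proof -
      have m: "1 \<le> m" "m \<le> M" using that unfolding squarefree_over_def by auto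
      have "m * m * D \<le> N"
        using MD mult_le_mono[OF m(2) m(2)] by (metis le_trans mult_le_mono1 power2_eq_square)
      then have "m * D \<le> N div m" using m by (simp add: less_eq_div_iff_mult_less_eq mult_ac)
      then show "N div m \<ge> D" using m by (metis le_trans mult_le_mono1 nat_mult_1)
      from \<open>m * D \<le> N div m\<close> have "m \<le> N div m div D" using D(1) by (simp add: less_eq_div_iff_mult_less_eq)
      then show "m < p" using that unfolding P_def by auto
      have "p \<le> N div m" using that unfolding P_def by auto
      then show "m * p \<le> N" using m by (simp add: less_eq_div_iff_mult_less_eq mult.commute)
    qed
    have "inj_on (\<lambda>(m, p). m * p) I"
    proof (rule inj_onI, clarify)
      fix m p m' p' assume *: "(m, p) \<in> I" "(m', p') \<in> I" "m * p = m' * p'"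
      have I: "m < p" "m' < p'" "prime p" "prime p'" "m \<ge> 1" "m' \<ge> 1"
        using * big(1)[of m p] big(1)[of m' p'] S_prime unfolding I_def P_def squarefree_over_def by auto
      \<comment> \<open>Distinct primes would divide each other's cofactors, giving the cycle p
        \<le> m' < p' \<le> m < p.\<close>
      have "p = p'"
      proof (rule ccontr)
        assume "p \<noteq> p'"
        then have "\<not> p dvd p'" "\<not> p' dvd p" using I primes_dvd_imp_eq by blast+
        moreover have "p dvd m' * p'" "p' dvd m * p" using *(3) by (metis dvd_triv_right)+
        ultimately have "p dvd m'" "p' dvd m" using I by (auto simp: prime_dvd_mult_iff)
        then have "p \<le> m'" "p' \<le> m" using I by (auto intro: dvd_imp_le)
        with I show False by linarith
      qed
      with *(3) I show "m = m' \<and> p = p'" by auto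
    qed
    then have "card I = card ((\<lambda>(m, p). m * p) ` I)" by (rule card_image[symmetric])
    also have "\<dots> \<le> card (squarefree_over S N)"
    proof (intro card_mono subsetI)
      fix n assume "n \<in> (\<lambda>(m, p). m * p) ` I"
      then obtain m p where n: "n = m * p" "m \<in> squarefree_over S M" "p \<in> P m" unfolding I_def by auto
      have p: "prime p" "p \<in> S" using n S_prime unfolding P_def by auto
      have m: "m \<ge> 1" "squarefree m" "prime_factors m \<subseteq> S" using n unfolding squarefree_over_def by auto
      have "\<not> p dvd m" using big(1)[OF n(2,3)] m by (auto dest: dvd_imp_le)
      then have "coprime m p" using p by (metis coprime_commute prime_imp_coprime)
      then have "squarefree n"
        unfolding n using m(2) squarefree_prime[OF p(1)] by (rule squarefree_mult_coprime)
      moreover have "prime_factors n \<subseteq> S"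
        unfolding n using m p prime_gt_0_nat[of p] by (subst prime_factors_product) (auto simp: prime_factorization_prime)
      ultimately show "n \<in> squarefree_over S N"
        using big(3)[OF n(2,3)] m p prime_gt_0_nat[of p] unfolding n squarefree_over_def by auto
    qed auto
    finally have "card I \<le> card (squarefree_over S N)" .
    moreover have "card I = (\<Sum>m\<in>squarefree_over S M. card (P m))"
      unfolding I_def P_def by (intro card_SigmaI) auto
    ultimately have "(\<Sum>m\<in>squarefree_over S M. real (card (P m))) \<le> real (card (squarefree_over S N))"
      by (metis of_nat_le_iff of_nat_sum)
    moreover have "(\<Sum>m\<in>squarefree_over S M. real N / (2 * real D * ln (real N)) * (1 / real m))
        \<le> (\<Sum>m\<in>squarefree_over S M. real (card (P m)))"
    proof (intro sum_mono)
      fix m assume "m \<in> squarefree_over S M"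
      then have m: "1 \<le> m" "m \<le> M" unfolding squarefree_over_def by auto
      have "m * m * D \<le> N"
        using MD mult_le_mono[OF m(2) m(2)] by (metis le_trans mult_le_mono1 power2_eq_square)
      then have "m * D \<le> N div m" using m by (simp add: less_eq_div_iff_mult_less_eq mult_ac)
      then have Y: "N div m \<ge> D" using m by (metis le_trans mult_le_mono1 nat_mult_1)
      then have lY: "0 < ln (real (N div m))" "ln (real (N div m)) \<le> ln (real N)"
        using D(1) div_le_dividend[of N m] by (auto intro!: ln_mono)
      \<comment> \<open>Since N div m is at least 1, rounding loses at most a factor 2, which
        accounts for the 2 in the denominator.\<close>
      have "real N / real m < real (N div m) + 1" by (rule real_nat_div_gt)
      also have "\<dots> \<le> 2 * real (N div m)" using Y D(1) by auto
      finally have "real N / real m / 2 \<le> real (N div m)" by simp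
      have "real N / (2 * real D * ln (real N)) * (1 / real m) = (real N / real m / 2) / (real D * ln (real N))"
        by simp
      also have "\<dots> \<le> real (N div m) / (real D * ln (real (N div m)))"
        using lY D(1) \<open>real N / real m / 2 \<le> real (N div m)\<close> by (intro frac_le mult_left_mono mult_pos_pos) auto
      also have "\<dots> \<le> real (card (P m))" unfolding P_def by (rule D(2)[OF Y])
      finally show "real N / (2 * real D * ln (real N)) * (1 / real m) \<le> real (card (P m))" .
    qed
    moreover have "real N / (2 * real D * ln (real N)) * (c * sqrt (ln (real N) / 4))
        \<le> real N / (2 * real D * ln (real N)) * (\<Sum>m\<in>squarefree_over S M. 1 / real m)"
    proof (intro mult_left_mono)
      have "c * sqrt (ln (real N) / 4) \<le> c * sqrt (ln (real M))"
        using lnM c(1) by (intro mult_left_mono) auto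
      also have "\<dots> \<le> (\<Sum>m\<in>squarefree_over S M. 1 / real m)" by (rule c(2)[OF M2])
      finally show "c * sqrt (ln (real N) / 4) \<le> (\<Sum>m\<in>squarefree_over S M. 1 / real m)" .
    qed (use lN in auto)
    moreover have "real N / (2 * real D * ln (real N)) * (c * sqrt (ln (real N) / 4))
        = c / (4 * real D) * real N / sqrt (ln (real N))"
    proof -
      define r where "r = sqrt (ln (real N))"
      have r: "r > 0" "ln (real N) = r * r" "sqrt (ln (real N) / 4) = r / 2"
        using lN by (simp_all add: r_def real_sqrt_divide)
      show ?thesis
        unfolding r(3) unfolding r_def[symmetric] unfolding r(2)
        using r(1) D(1) by (simp add: field_simps)
    qed
    ultimately show ?thesis by (simp add: sum_distrib_left)
  qed
  moreover have "c / (4 * real D) > 0" using c(1) D(1) by simp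
  ultimately show ?thesis using that by blast
qed

end

section \<open>The Legendre symbol modulo 37\<close>

text \<open>Euler's criterion makes the symbol computable.\<close>

lemma Legendre_37:
  "Legendre a 37 = (if a ^ 18 mod 37 = 0 then 0 else if a ^ 18 mod 37 = 1 then 1 else -1)"
proof -
  have "[Legendre a (int 37) = a ^ ((37 - 1) div 2)] (mod int 37)"
    by (rule euler_criterion) auto
  then have "a ^ 18 mod 37 = Legendre a 37 mod 37" by (simp add: cong_def)
  moreover have "Legendre a 37 \<in> {0, 1, -1}" by (auto simp: Legendre_def)
  ultimately show ?thesis by auto
qed

text \<open>By Euler's criterion the two sides agree modulo 37, and both have absolute value at most
  1.\<close>

lemma Legendre_37_mult: "Legendre (a * b) 37 = Legendre a 37 * Legendre b 37"
proof -
  have eul: "[Legendre a (int 37) = a ^ ((37 - 1) div 2)] (mod int 37)" for a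
    by (rule euler_criterion) auto
  have "[Legendre (a * b) 37 = Legendre a 37 * Legendre b 37] (mod 37)"
    using eul[of "a * b"] cong_mult[OF eul[of a] eul[of b]]
    by (simp add: power_mult_distrib cong_def)
  then have "37 dvd Legendre (a * b) 37 - Legendre a 37 * Legendre b 37"
    by (simp add: cong_iff_dvd_diff)
  moreover have "Legendre a 37 \<in> {0, 1, -1}" for a by (auto simp: Legendre_def)
  then have "\<bar>Legendre a 37\<bar> \<le> 1" for a by (metis abs_0 abs_1 abs_minus_cancel insert_iff order_refl singletonD zero_le_one)
  then have "\<bar>Legendre (a * b) 37\<bar> \<le> 1" "\<bar>Legendre a 37 * Legendre b 37\<bar> \<le> 1"
    by (auto simp: abs_mult intro!: mult_le_one)
  then have "\<bar>Legendre (a * b) 37 - Legendre a 37 * Legendre b 37\<bar> < 37" by linarith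
  ultimately show ?thesis using zdvd_imp_le[of 37 "\<bar>Legendre (a * b) 37 - Legendre a 37 * Legendre b 37\<bar>"] by auto
qed

definition leg37 :: "nat \<Rightarrow> int" where "leg37 n = Legendre (int n) 37"

lemma leg37_add: "leg37 (37 + n) = leg37 n"
proof -
  have "(37 + int n) ^ 18 mod 37 = int n ^ 18 mod 37"
    by (metis mod_add_self1 power_mod)
  then show ?thesis unfolding leg37_def Legendre_37 by simp
qed

lemma leg37_table:
  "map leg37 [0..<37] = [0, 1, -1, 1, 1, -1, -1, 1, -1, 1, 1, 1, 1, -1, -1, -1, 1, -1, -1, -1, -1, 1, -1, -1, -1, 1, 1, 1, 1, -1, 1, -1, -1, 1, 1, -1, 1]"
  unfolding leg37_def Legendre_37 by code_simp

text \<open>A full period sums to 0, so only the initial segments of one period matter; these are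
  checked on the table.\<close>

lemma sum_leg37_bound: "\<bar>\<Sum>n<k. leg37 n\<bar> \<le> 4"
proof (induction k rule: less_induct)
  case (less k)
  have take: "(\<Sum>n<k. leg37 n) = sum_list (take k (map leg37 [0..<37]))" if "k \<le> 37" for k
    using that by (simp add: take_map sum_list_distinct_conv_sum_set lessThan_atLeast0)
  show ?case
  proof (cases "k < 37")
    case True
    have "list_all (\<lambda>k. \<bar>sum_list (take k (map leg37 [0..<37]))\<bar> \<le> 4) [0..<37]"
      unfolding leg37_table by code_simp
    then show ?thesis using True take[of k] by (simp add: list_all_iff)
  next
    case False
    then obtain j where j: "k = 37 + j" using le_Suc_ex not_less by blast
    have "(\<Sum>n<37 + j. leg37 n) = (\<Sum>n<37. leg37 n) + (\<Sum>n<j. leg37 (37 + n))" for j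
    proof (induction j)
      case (Suc j)
      show ?case by (simp only: Suc.IH add_Suc_right sum.lessThan_Suc add.assoc)
    qed simp
    moreover have "(\<Sum>n<37. leg37 n) = 0"
      unfolding take[OF order.refl] leg37_table by simp
    ultimately show ?thesis using less[of j] j by (simp add: leg37_add)
  qed
qed

text \<open>The bound 8 arises because an interval sum is the difference of two initial sums of size
  at most 4.\<close>

interpretation leg: bounded_character "\<lambda>n. real_of_int (leg37 n)" 8
proof
  show "real_of_int (leg37 (m * n)) = real_of_int (leg37 m) * real_of_int (leg37 n)" for m n
    by (simp add: leg37_def Legendre_37_mult)
  show "\<bar>real_of_int (leg37 n)\<bar> \<le> 1" for n
    by (auto simp: leg37_def Legendre_def)
  show "\<bar>\<Sum>n=a..<b. real_of_int (leg37 n)\<bar> \<le> 8" for a b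
  proof (cases "a \<le> b")
    case True
    then have "{..<b} = {..<a} \<union> {a..<b}" by auto
    then have "(\<Sum>n<b. leg37 n) = (\<Sum>n<a. leg37 n) + (\<Sum>n=a..<b. leg37 n)"
      by (simp add: sum.union_disjoint ivl_disj_int)
    then have "\<bar>\<Sum>n=a..<b. leg37 n\<bar> \<le> 8"
      using sum_leg37_bound[of a] sum_leg37_bound[of b] by linarith
    then show ?thesis by (metis of_int_abs of_int_le_iff of_int_numeral of_int_sum)
  qed auto
qed

text \<open>Twelve terms suffice: their sum exceeds 1, while the error bound is 8 / 13.\<close>

lemma L_pos: "leg.L > 0"
proof -
  have v: "leg37 n = map leg37 [0..<37] ! n" if "n < 37" for n
    using that by simp
  have "{1..12::nat} = {1, 2, 3, 4, 5, 6, 7, 8, 9, 10, 11, 12}"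
    by code_simp
  then have "leg.partial_L 12 > 1"
    unfolding leg.partial_L_def by (simp add: v leg37_table)
  moreover have "\<bar>leg.partial_L 12 - leg.L\<bar> < 1"
    by (rule le_less_trans[OF leg.partial_L_bound]) simp
  ultimately show ?thesis by linarith
qed

text \<open>The prime 3 splits too but is reserved for adjusting the class modulo 4, so that 3 n
  stays squarefree.\<close>

definition S37 :: "nat set" where "S37 = {p. prime p \<and> leg37 p = 1 \<and> p \<noteq> 3}"
definition T37 :: "nat set" where "T37 = {p. prime p \<and> p \<notin> S37}"

lemma half_primes_37: "\<exists>C. half_primes S37 T37 C"
proof -
  have pm: "real_of_int (leg37 p) = 1 \<or> real_of_int (leg37 p) = -1" if "prime p" "p \<notin> {3, 37}" for p
  proof -
    have "\<not> 37 dvd p" using that primes_dvd_imp_eq[of 37 p] by auto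
    then have "\<not> [int p = 0] (mod 37)" by (simp add: cong_0_iff) presburger
    then show ?thesis by (auto simp: leg37_def Legendre_def)
  qed
  have L: "leg.L \<noteq> 0" using L_pos by simp
  \<comment> \<open>The exceptional primes are 37, where the symbol is 0, and 3, which has symbol 1
    but was left out of \<open>S37\<close>.\<close>
  have "\<exists>C. \<forall>N\<ge>1. \<bar>(\<Sum>p | p \<in> {1..N} \<and> prime p \<and> p \<in> S37. ln (real p) / real p) - ln (real N) / 2\<bar> \<le> C"
    by (rule leg.mertens_half[OF L, of "{3, 37}" _ 1]) (use pm in \<open>auto simp: S37_def\<close>)
  then obtain C1 where C1: "\<And>N. N \<ge> 1 \<Longrightarrow> \<bar>(\<Sum>p | p \<in> {1..N} \<and> prime p \<and> p \<in> S37. ln (real p) / real p) - ln (real N) / 2\<bar> \<le> C1"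
    by blast
  have "\<exists>C. \<forall>N\<ge>1. \<bar>(\<Sum>p | p \<in> {1..N} \<and> prime p \<and> p \<in> T37. ln (real p) / real p) - ln (real N) / 2\<bar> \<le> C"
    by (rule leg.mertens_half[OF L, of "{3, 37}" _ "-1"]) (use pm in \<open>auto simp: S37_def T37_def\<close>)
  then obtain C2 where C2: "\<And>N. N \<ge> 1 \<Longrightarrow> \<bar>(\<Sum>p | p \<in> {1..N} \<and> prime p \<and> p \<in> T37. ln (real p) / real p) - ln (real N) / 2\<bar> \<le> C2"
    by blast
  have sets: "{p. p \<in> {1..N} \<and> prime p \<and> p \<in> S37} = S37 \<inter> {1..N}"
    "{p. p \<in> {1..N} \<and> prime p \<and> p \<in> T37} = T37 \<inter> {1..N}" for N
    by (auto simp: S37_def T37_def)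
  have "half_primes S37 T37 (max C1 C2)"
  proof
    fix N :: nat assume N: "N \<ge> 1"
    show "\<bar>(\<Sum>p\<in>S37 \<inter> {1..N}. ln (real p) / real p) - ln (real N) / 2\<bar> \<le> max C1 C2"
      using C1[OF N] unfolding sets by linarith
    show "(\<Sum>p\<in>T37 \<inter> {1..N}. ln (real p) / real p) \<le> ln (real N) / 2 + max C1 C2"
      using C2[OF N] unfolding sets by linarith
  qed (auto simp: S37_def T37_def)
  then show ?thesis by blast
qed

lemma S37D:
  assumes "p \<in> S37"
  shows "prime p" "odd p" "p \<noteq> 3" "p \<noteq> 37" "norm37 (int p)"
proof -
  have v: "leg37 n = map leg37 [0..<37] ! n" if "n < 37" for n
    using that by simp
  show p: "prime p" and "p \<noteq> 3" using assms by (auto simp: S37_def)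
  have leg: "leg37 p = 1" using assms by (auto simp: S37_def)
  \<comment> \<open>Both 2 and 5 have symbol -1 in the table.\<close>
  have "p \<noteq> 2" "p \<noteq> 5"
    using leg v[of 2] v[of 5] by (auto simp: leg37_table)
  show "p \<noteq> 37"
    using leg by (auto simp: leg37_def Legendre_37)
  show "odd p" using p \<open>p \<noteq> 2\<close> prime_odd_nat[of p] prime_ge_2_nat[of p] by auto
  \<comment> \<open>The exponent contains the even factor 18, so reciprocity makes 37 a square
    modulo p.\<close>
  have "Legendre (int p) (int 37) * Legendre (int 37) (int p) = (-1) ^ ((p - 1) div 2 * ((37 - 1) div 2))"
    using p \<open>p \<noteq> 2\<close> \<open>p \<noteq> 37\<close> prime_ge_2_nat[of p] by (intro Quadratic_Reciprocity) auto
  then have "Legendre 37 (int p) = 1" using leg by (simp add: leg37_def)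
  then have "QuadRes (int p) 37" by (auto simp: Legendre_def split: if_splits)
  then show "norm37 (int p)" using p \<open>p \<noteq> 2\<close> \<open>p \<noteq> 5\<close> by (intro norm37_prime)
qed

section \<open>From squarefree products to imaginary quadratic fields\<close>

lemma squarefree_int:
  assumes "squarefree n"
  shows "squarefree (int n)"
proof (rule squarefreeI)
  fix x assume "x ^ 2 dvd int n"
  then have "int (nat \<bar>x\<bar> ^ 2) dvd int n" by simp
  then have "nat \<bar>x\<bar> ^ 2 dvd n" by (simp only: int_dvd_int_iff)
  then have "nat \<bar>x\<bar> dvd 1" using assms squarefreeD by blast
  then show "x dvd 1" by simp
qed

definition good_disc :: "int \<Rightarrow> bool" where
  "good_disc d \<longleftrightarrow> (\<exists>a1 a2 a3 a4 a6. elliptic_over (qfield d) a1 a2 a3 a4 a6 \<and>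
     everywhere_good_reduction (qfield d) a1 a2 a3 a4 a6 \<and> wj a1 a2 a3 a4 a6 \<in> \<rat>)"

lemma good_disc_norm37:
  assumes "squarefree m" "norm37 m" "m > 0" "m mod 4 = 3" "\<not> 37 dvd m"
  shows "good_disc (- 37 * m)"
proof -
  obtain x y z where "conic_point m x y z" using norm37_conic_point[OF assms] by blast
  then interpret conic_point m x y z .
  show ?thesis
    using elliptic_over_qfield everywhere_good_reduction wj_rational unfolding good_disc_def d_def by blast
qed

text \<open>For odd n the factor 3 moves the class 1 modulo 4 to 3, and since 3 is a norm from
  Q(sqrt 37), being a norm is preserved.\<close>

definition multiplier :: "nat \<Rightarrow> nat" where
  "multiplier n = (if n mod 4 = 3 then n else 3 * n)"

lemma squarefree_over_S37:
  assumes "n \<in> squarefree_over S37 N"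
  shows "good_disc (- 37 * int (multiplier n))" "squarefree (- 37 * int (multiplier n))"
    "\<not> 3 dvd n" "multiplier n > 0" "multiplier n \<le> 3 * N" "multiplier n mod 4 = 3"
proof -
  have n: "n \<ge> 1" "n \<le> N" "squarefree n" "prime_factors n \<subseteq> S37"
    using assms by (auto simp: squarefree_over_def)
  have S: "p \<in> S37" if "prime p" "p dvd n" for p
    using n that by (auto simp: prime_factors_dvd)
  show n3: "\<not> 3 dvd n" using S[of 3] S37D(3) by auto
  have n37: "\<not> 37 dvd n" using S[of 37] S37D(4) by auto
  have "odd n" using S[of 2] S37D(2)[of 2] by auto
  then have n4: "n mod 4 = 1 \<or> n mod 4 = 3" by presburger
  have "norm37 (\<Prod>p\<in>prime_factors n. int p)"
    using n S37D(5) by (intro norm37_prod) auto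
  also have "(\<Prod>p\<in>prime_factors n. int p) = int (\<Prod>(prime_factors n))"
    by (rule of_nat_prod[symmetric])
  also have "\<Prod>(prime_factors n) = n"
    by (rule squarefree_eq_prod_prime_factors[OF n(3), symmetric])
  finally have norm: "norm37 (int n)" .
  let ?m = "multiplier n"
  have normm: "norm37 (int ?m)"
    using norm norm37_mult[OF norm37_3 norm] by (simp add: multiplier_def)
  have "coprime 3 n" using n3 by (intro prime_imp_coprime) auto
  then have sq: "squarefree ?m"
    using squarefree_mult_coprime[OF _ squarefree_prime n(3), of 3] n(3) by (simp add: multiplier_def)
  have m37: "\<not> 37 dvd ?m"
    using n37 prime_dvd_mult_iff[of 37 3 n] by (simp add: multiplier_def)
  show m4: "?m mod 4 = 3" using n4 by (auto simp: multiplier_def) presburger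
  show m0: "?m > 0" "?m \<le> 3 * N" using n by (auto simp: multiplier_def)
  show "good_disc (- 37 * int ?m)"
  proof (rule good_disc_norm37[OF squarefree_int[OF sq] normm])
    show "int ?m mod 4 = 3" using m4 by presburger
    show "\<not> 37 dvd int ?m" using m37 int_dvd_int_iff[of 37 ?m] by simp
  qed (use m0 in simp)
  have "coprime 37 ?m" using m37 by (intro prime_imp_coprime) auto
  then have "squarefree (37 * ?m)"
    using sq by (intro squarefree_mult_coprime) (auto intro: squarefree_prime)
  then show "squarefree (- 37 * int ?m)"
    using squarefree_int[of "37 * ?m"] by simp
qed

lemma card_squarefree_over_le_I_count:
  assumes "111 * real N < X"
  shows "card (squarefree_over S37 N) \<le> I_count X"
proof -
  let ?D = "{d :: int. d < 0 \<and> squarefree d \<and> real_of_int \<bar>qdisc d\<bar> < X \<and> good_disc d}"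
  have "finite ?D"
  proof (rule finite_subset)
    show "?D \<subseteq> {- \<lceil>X\<rceil>..0}"
    proof
      fix d assume d: "d \<in> ?D"
      then have "\<bar>d\<bar> \<le> \<bar>qdisc d\<bar>" by (auto simp: qdisc_def)
      with d have "real_of_int \<bar>d\<bar> < X" by (smt (verit) mem_Collect_eq of_int_le_iff)
      with d show "d \<in> {- \<lceil>X\<rceil>..0}" by auto linarith
    qed
  qed auto
  \<comment> \<open>Since 3 does not divide n, divisibility of the multiplier by 3 reveals whether
    the factor 3 was inserted.\<close>
  have "inj_on (\<lambda>n. - 37 * int (multiplier n)) (squarefree_over S37 N)"
  proof (rule inj_onI)
    fix m n assume *: "m \<in> squarefree_over S37 N" "n \<in> squarefree_over S37 N"
      "- 37 * int (multiplier m) = - 37 * int (multiplier n)"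
    then show "m = n"
      using squarefree_over_S37(3)[OF *(1)] squarefree_over_S37(3)[OF *(2)]
      by (auto simp: multiplier_def split: if_splits)
  qed
  then have "card (squarefree_over S37 N) = card ((\<lambda>n. - 37 * int (multiplier n)) ` squarefree_over S37 N)"
    by (rule card_image[symmetric])
  also have "\<dots> \<le> card ?D"
  proof (intro card_mono \<open>finite ?D\<close> subsetI)
    fix d assume "d \<in> (\<lambda>n. - 37 * int (multiplier n)) ` squarefree_over S37 N"
    then obtain n where n: "n \<in> squarefree_over S37 N" "d = - 37 * int (multiplier n)" by blast
    note * = squarefree_over_S37[OF n(1)]
    \<comment> \<open>This class makes the discriminant d itself, of absolute value at most 37 * 3 *
      N = 111 N.\<close>
    have "d mod 4 = 1" using *(6) unfolding n(2) by presburger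
    then have "\<bar>qdisc d\<bar> = 37 * int (multiplier n)" using n(2) by (simp add: qdisc_def)
    moreover have "37 * real (multiplier n) \<le> 111 * real N" using *(5) by linarith
    ultimately have "real_of_int \<bar>qdisc d\<bar> < X" using assms by simp
    then show "d \<in> ?D" using * n(2) by auto
  qed
  also have "card ?D = I_count X" unfolding I_count_def good_disc_def ..
  finally show ?thesis .
qed

theorem theorem1p2:
  shows "\<exists>c > 0. \<forall>\<^sub>F X in at_top. c * X / sqrt (ln X) \<le> real (I_count X)"
proof -
  obtain C where "half_primes S37 T37 C" using half_primes_37 by blast
  then obtain c N0 where c: "c > 0"
    "\<And>N. N \<ge> N0 \<Longrightarrow> c * real N / sqrt (ln (real N)) \<le> real (card (squarefree_over S37 N))"
    using half_primes.card_squarefree_over_ge by blast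
  have "c / 224 * X / sqrt (ln X) \<le> real (I_count X)" if X: "X \<ge> 224 * (real N0 + 1)" for X
  proof -
    \<comment> \<open>Dividing by 112 makes 111 N < X strict, and for large X rounding still leaves
      N \<ge> X / 224.\<close>
    define N where "N = nat \<lfloor>X / 112\<rfloor>"
    have X0: "X \<ge> 224" using X by simp
    have N: "real N \<le> X / 112" "X / 112 < real N + 1"
      using X0 unfolding N_def by linarith+
    have "real N > 1" using N(2) X0 by linarith
    then have N2: "real N \<ge> 2" by simp
    have "2 * real N0 + 2 \<le> X / 112" using X by simp
    then have "real N0 \<le> real N" using N(2) by linarith
    then have NX: "real N \<ge> X / 224" "real N \<le> X" "N \<ge> N0" using N X0 by auto
    have "c / 224 * X / sqrt (ln X) = c * (X / 224) / sqrt (ln X)" by simp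
    also have "\<dots> \<le> c * real N / sqrt (ln (real N))"
      using NX N2 X0 c(1) by (intro frac_le mult_left_mono) auto
    also have "\<dots> \<le> real (card (squarefree_over S37 N))" by (rule c(2)[OF NX(3)])
    also have "\<dots> \<le> real (I_count X)"
      using N X0 by (intro of_nat_mono card_squarefree_over_le_I_count) linarith
    finally show ?thesis .
  qed
  then have "\<forall>\<^sub>F X in at_top. c / 224 * X / sqrt (ln X) \<le> real (I_count X)"
    by (intro eventually_at_top_linorderI) auto
  then show ?thesis using c(1) by (intro exI[of _ "c / 224"]) auto
qed

end
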